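(* Consider a ring network whose agents know that $n\sim\sigma$, where $\sigma$ is the uniform prior on the integers of an interval $[\alpha,\beta]$. Then the protocol "Knowledge Sharing in a Ring" (described in the context) is a distributed equilibrium for Knowledge Sharing (i.e., an equilibrium for $k$-Knowledge Sharing for every $k$) if and only if $\beta\le 2\alpha-1$.
   Context: **Network and agents.** The network is a bidirectional ring with $n$ nodes ($n$ always denotes the actual number of nodes), with a global orientation. Each node is an agent with unlimited computational power. Agents communicate over edges in synchronous rounds and all start at round $0$. Initially each agent knows its own id and private input (including its preference), but not those of other agents. Private information comes from a finite set, and each agent's prior over the private information of the others is uniform. The agents do not know $n$ but know its prior $\sigma$. *Uniform prior on $[\alpha,\beta]$*: $\Pr[n\le t]=\frac{t-\alpha+1}{\beta-\alpha+1}$ for integers $\alpha\le t\le\beta$. **Outputs and utilities.** Agent $a$ outputs $o_a$ ($\bot$ means it aborts). Output vectors are $O=(o_1,\dots,o_n)\in\Theta=\Theta_L\sqcup\Theta_E$, where $\Theta_L$ is the set of legal and $\Theta_E$ the set of erroneous output vectors. Each agent $a$ has a single preferred output value $p_a$ and utility $u_a(O)=1$ if $o_a=p_a$ and $O\in\Theta_L$, and $u_a(O)=0$ otherwise. An agent that detects that another agent deviated outputs $\bot$, which makes the output erroneous. **Equilibrium.** For a step $s$ (the entire operation of an agent in one round) of agent $a$ at round $r$ of an execution, $\mathbb{E}_{s,r}[u_a]=\sum_{O\in\Theta}x_O(s,r)u_a(O)$, where $x_O(s,r)$ is the probability, estimated by $a$ at round $r$, that $O$ is output if $a$ takes step $s$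 and all other agents follow the algorithm. An algorithm $\Lambda$ whose next step at round $r$ is $s(r)$ is a (distributed) equilibrium if for every agent $a$, every round $r$ of every possible execution in which all steps up to round $r$ were according to $\Lambda$, and every deviating step $\bar s$: $\mathbb{E}_{s(r),r}[u_a]\ge \mathbb{E}_{\bar s,r}[u_a]$. Only a single agent deviates (no coalitions). **Duplication (Sybil attack).** A deviating agent may pretend to be $d$ agents, by simulating $d$ imaginary agents with fake ids and distributing its edges among them. The other agents then execute the algorithm as if on the enlarged ring, of size $n'=n+d-1$. Fake id collisions are disregarded. The cheater still produces a single output, and legality is judged on the output vector of the $n$ real agents. The number $d$ is decided at round $0$, before Wake-Up is completed. If $n'=d+n-1>\beta$, the duplication is detected and the output is erroneous. **$k$-Knowledge Sharing and Knowledge Sharing.** Each agent $a$ has a private input $i_a$; all agents have the same function $q$ with $|\mathrm{range}(q)|=k$, where $k$ and the output space are known to all agents. An output vector is legal iff all agents output the same value $\neq\bot$. The output is correct if every agent outputs $q(I)$, with $I$ the inputs of all agents. The function $q$ satisfies the Full Knowledge property: for any number $m$ of inputs, any $1\le j\le m$ and any fixed $(x_1,\dots,x_{j-1},x_{j+1},\dots,x_m)$, the number $|\{x_j : q(x_1,\dots,x_m)=y\}|$ is the same for every $y$ in the range of $q$ (inputs being uniform). Each agent $a$ prefers a certain output value $p_a$. A protocol for Knowledge Sharing solves $k$-Knowledge Sharing for every possible $k$, and it is an equilibrium if for any possible $k$ no agent has an incentive to cheat. **Secret-Transmit$(i_a,r,b)$.** Agent $a$ selects a random number $R_a$ and sets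 $X_a=R_a\oplus i_a$. It sends $R_a$ clockwise and $X_a$ counter-clockwise, each being forwarded until it reaches the agent just before $b$. At round $r-1$ the two neighbors of $b$ simultaneously send these two values to $b$, so $b$ learns $i_a$ at round $r$. **Protocol "Knowledge Sharing in a Ring".** (1) All agents execute Wake-Up, a preliminary phase after which every agent knows the ids of all agents and the size $n'$ of the ring (possibly including duplicated agents). (2) For each agent $a$ let $b^1_a$ be the clockwise neighbor of $a$ and $b^2_a$ the agent at distance $\lfloor n'/2\rfloor$ counter-clockwise from $a$. (3) Each agent $a$ simultaneously performs Secret-Transmit$(i_a,n',b^1_a)$ and Secret-Transmit$(i_a,n',b^2_a)$. (4) At round $n'+1$ each agent sends its input around the ring. (5) At round $2n'$ each agent outputs $q(I)$. *)

theory Defs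
  imports "HOL-Probability.Probability"
begin

section \<open>Knowledge Sharing tasks\<close>

text \<open>Inputs are bit strings of length \<open>width\<close>, coded as natural numbers below \<open>2 ^ width\<close>, so that
  the masking of Secret-Transmit is a bitwise XOR. The set of possible inputs may be any finite
  nonempty set of such strings; in particular its size need not be a power of two.\<close>

record task =
  inputs :: "nat set"
  width  :: nat
  fn     :: "nat list \<Rightarrow> nat"

definition fn_range :: "task \<Rightarrow> nat set" where
  "fn_range T = fn T ` {xs. xs \<noteq> [] \<and> set xs \<subseteq> inputs T}"

definition full_knowledge :: "task \<Rightarrow> bool" where
  "full_knowledge T \<longleftrightarrow>
     (\<forall>xs j. set xs \<subseteq> inputs T \<longrightarrow> j < length xs \<longrightarrow>
        (\<forall>y\<in>fn_range T. \<forall>y'\<in>fn_range T.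
           card {x \<in> inputs T. fn T (xs[j := x]) = y} = card {x \<in> inputs T. fn T (xs[j := x]) = y'}))"

definition k_task :: "nat \<Rightarrow> task \<Rightarrow> bool" where
  "k_task k T \<longleftrightarrow>
     finite (inputs T) \<and> inputs T \<noteq> {} \<and> inputs T \<subseteq> {..<2 ^ width T} \<and>
     finite (fn_range T) \<and> card (fn_range T) = k \<and> full_knowledge T"

text \<open>What an agent holds besides its id and its preference: its input, and the two random numbers it
  uses for its two secret transmissions.\<close>

type_synonym private_data = "nat \<times> nat \<times> nat"

definition privates :: "task \<Rightarrow> private_data set" where
  "privates T = inputs T \<times> {..<2 ^ width T} \<times> {..<2 ^ width T}"

text \<open>The inputs \<open>I\<close> are passed to \<open>q\<close> in the order of increasing ids; \<open>X i\<close> is the input of the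
  agent whose id is \<open>L ! i\<close>.\<close>

definition eval_fn :: "task \<Rightarrow> nat list \<Rightarrow> (nat \<Rightarrow> nat) \<Rightarrow> nat" where
  "eval_fn T L X = fn T (map X (sort_key (\<lambda>i. L ! i) [0..<length L]))"


section \<open>Synchronous executions on a ring\<close>

text \<open>Clockwise is the direction of increasing positions. A pair of messages always lists the message
  that travels clockwise first. Hence a step sends its first component to the clockwise neighbour,
  while the first component of a received pair comes from the counter-clockwise neighbour. The current
  round is the length of the history.\<close>

datatype side = Near | Far

datatype item =
    Share nat side nat  \<comment> \<open>origin, for \<open>b\<^sup>1\<close> or for \<open>b\<^sup>2\<close> of the origin, value\<close>
  | Input nat nat       \<comment> \<open>origin, value\<close>

type_synonym msg = "item set"
type_synonym history = "(msg \<times> msg) list"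
type_synonym behaviour = "history \<Rightarrow> msg \<times> msg"
type_synonym strategy = "behaviour \<times> (history \<Rightarrow> nat option)"

fun run :: "nat \<Rightarrow> (nat \<Rightarrow> behaviour) \<Rightarrow> nat \<Rightarrow> nat \<Rightarrow> history" where
  "run n B 0 j = []"
| "run n B (Suc t) j =
     (let ccw_nb = (j + n - 1) mod n; cw_nb = (j + 1) mod n
      in run n B t j @ [(fst (B ccw_nb (run n B t ccw_nb)), snd (B cw_nb (run n B t cw_nb)))])"

text \<open>An algorithm is run after Wake-Up by an agent that knows the clockwise list \<open>L\<close> of all ids, its
  own index in \<open>L\<close> and its private data. An index \<open>i\<close> serves as a name for the agent with id \<open>L ! i\<close>;
  the point at which the list \<open>L\<close> is cut open is immaterial. Round \<open>0\<close> is the first round after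
  Wake-Up, and outputs are produced at round \<open>2 * length L\<close>.\<close>

type_synonym algorithm = "task \<Rightarrow> nat list \<Rightarrow> nat \<Rightarrow> private_data \<Rightarrow> strategy"


section \<open>The protocol Knowledge Sharing in a Ring\<close>

fun target :: "nat \<Rightarrow> side \<Rightarrow> nat \<Rightarrow> nat" where
  "target N Near a = (a + 1) mod N"
| "target N Far a = (a + N - N div 2) mod N"

fun cw_value :: "private_data \<Rightarrow> side \<Rightarrow> nat" where
  "cw_value (x, r1, r2) Near = r1"
| "cw_value (x, r1, r2) Far = r2"

definition ccw_value :: "private_data \<Rightarrow> side \<Rightarrow> nat" where
  "ccw_value v s = Bit_Operations.xor (cw_value v s) (fst v)"

text \<open>Both secret transmissions in one direction of travel. \<open>nb\<close> is the neighbour in that direction,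
  \<open>own\<close> the agent's own shares for that direction, and \<open>rcvd\<close> the messages received so far that
  travel in that direction. A share is passed on at once unless the next agent is its target, in which
  case it waits until round \<open>N - 1\<close>; so the target learns the secret at round \<open>N\<close>.\<close>

definition relay :: "nat \<Rightarrow> nat \<Rightarrow> msg \<Rightarrow> msg list \<Rightarrow> msg" where
  "relay N nb own rcvd =
     (if length rcvd + 1 < N then
        {Share a s y | a s y. Share a s y \<in> (if rcvd = [] then own else last rcvd) \<and> target N s a \<noteq> nb}
      else if length rcvd + 1 = N then
        {Share a s y | a s y. Share a s y \<in> own \<union> \<Union> (set rcvd) \<and> target N s a = nb}
      else {})"

definition ring_behaviour :: "nat \<Rightarrow> nat \<Rightarrow> private_data \<Rightarrow> behaviour" where
  "ring_behaviour N j v h =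
     (let t = length h; cw_nb = (j + 1) mod N; ccw_nb = (j + N - 1) mod N in
      if t < N then
        (relay N cw_nb  {Share j s (cw_value v s)  | s. True} (map fst h),
         relay N ccw_nb {Share j s (ccw_value v s) | s. True} (map snd h))
      else if t = N + 1 then ({Input j (fst v)}, {})
      else if N + 1 < t \<and> t < 2 * N then
        ({Input a x | a x. Input a x \<in> fst (last h) \<and> a \<noteq> cw_nb}, {})
      else ({}, {}))"

text \<open>An agent detects a deviation iff no execution in which all agents follow the protocol explains
  the messages that it has received.\<close>

definition no_deviation_detected :: "task \<Rightarrow> nat \<Rightarrow> nat \<Rightarrow> private_data \<Rightarrow> history \<Rightarrow> bool" where
  "no_deviation_detected T N j v H \<longleftrightarrow>
     (\<exists>V. V j = v \<and> (\<forall>i<N. V i \<in> privates T) \<and>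
          H = run N (\<lambda>i. ring_behaviour N i (V i)) (2 * N) j)"

definition known_input :: "nat \<Rightarrow> private_data \<Rightarrow> history \<Rightarrow> nat \<Rightarrow> nat" where
  "known_input j v H i = (if i = j then fst v else (THE x. \<exists>m\<in>set H. Input i x \<in> fst m))"

definition ring_output :: "task \<Rightarrow> nat list \<Rightarrow> nat \<Rightarrow> private_data \<Rightarrow> history \<Rightarrow> nat option" where
  "ring_output T L j v H =
     (if no_deviation_detected T (length L) j v H then Some (eval_fn T L (known_input j v H)) else None)"

definition ring_protocol :: algorithm where
  "ring_protocol T L j v = (ring_behaviour (length L) j v, ring_output T L j v)"


section \<open>Outputs, utilities and deviations\<close>

definition legal :: "nat option list \<Rightarrow> bool" where
  "legal Os \<longleftrightarrow> (\<exists>y. \<forall>o'\<in>set Os. o' = Some y)"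

definition utility :: "nat \<Rightarrow> nat option list \<Rightarrow> real" where
  "utility p Os = (if Os ! 0 = Some p \<and> legal Os then 1 else 0)"

text \<open>Positions on the real ring of \<open>n\<close> agents are counted clockwise from the agent under
  consideration, which therefore is agent \<open>0\<close> and uses strategy \<open>S\<close>; agents \<open>1, \<dots>, n - 1\<close> follow the
  algorithm \<open>\<Lambda>\<close>. They believe in the ring \<open>L\<close>, whose first \<open>length L - n + 1\<close> entries are all
  simulated by agent \<open>0\<close>. Agent \<open>0\<close> keeps one edge at either end of this block, so physically it is a
  single agent with two edges.\<close>

definition outputs ::
  "algorithm \<Rightarrow> task \<Rightarrow> nat \<Rightarrow> nat list \<Rightarrow> strategy \<Rightarrow> (nat \<Rightarrow> private_data) \<Rightarrow> nat option list" where
  "outputs \<Lambda> T n L S w =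
     (let N = length L;
          A = (\<lambda>j. if j = 0 then S else \<Lambda> T L (j + (N - n)) (w j));
          H = run n (\<lambda>j. fst (A j)) (2 * N)
      in map (\<lambda>j. snd (A j) (H j)) [0..<n])"

text \<open>A plan fixes, before Wake-Up is completed, the ids under which an agent appears (their number is
  \<open>d\<close>), and how it acts once Wake-Up has revealed the ring \<open>L\<close>. Plans, and strategies below, may be
  randomized.\<close>

type_synonym plan = "nat list \<times> (nat list \<Rightarrow> strategy)"

definition valid_plan :: "nat set \<Rightarrow> plan pmf \<Rightarrow> bool" where
  "valid_plan Ids P \<longleftrightarrow> (\<forall>(fids, S) \<in> set_pmf P. fids \<noteq> [] \<and> distinct fids \<and> set fids \<subseteq> Ids)"

definition honest_plan :: "algorithm \<Rightarrow> task \<Rightarrow> nat \<Rightarrow> nat \<Rightarrow> plan pmf" where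
  "honest_plan \<Lambda> T me x =
     map_pmf (\<lambda>(r1, r2). ([me], \<lambda>L. \<Lambda> T L 0 (x, r1, r2)))
       (pmf_of_set ({..<2 ^ width T} \<times> {..<2 ^ width T}))"

text \<open>Distribution of the output vector as estimated at the beginning, before Wake-Up. The ids of the
  other agents are drawn away from \<open>fids\<close>: collisions with fake ids are disregarded.\<close>

definition initial_outcome ::
  "algorithm \<Rightarrow> nat \<Rightarrow> nat \<Rightarrow> nat set \<Rightarrow> task \<Rightarrow> plan pmf \<Rightarrow> nat option list pmf" where
  "initial_outcome \<Lambda> \<alpha> \<beta> Ids T P =
     do {
       (fids, S) \<leftarrow> P;
       n \<leftarrow> pmf_of_set {\<alpha>..\<beta>};
       if length fids + n - 1 > \<beta> then return_pmf (replicate n None)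
       else do {
         ids \<leftarrow> pmf_of_set {ids. length ids = n - 1 \<and> distinct ids \<and> set ids \<subseteq> Ids - set fids};
         w \<leftarrow> pmf_of_set ({1..<n} \<rightarrow>\<^sub>E privates T);
         return_pmf (outputs \<Lambda> T n (fids @ ids) (S (fids @ ids)) w)
       }
     }"

text \<open>After Wake-Up of an agent that has not duplicated itself: what it has received before round \<open>r\<close>
  of an execution according to \<open>\<Lambda>\<close>, and the private data of the others given that this is \<open>h\<close>.\<close>

definition honest_view :: "algorithm \<Rightarrow> task \<Rightarrow> nat list \<Rightarrow> private_data \<Rightarrow> nat \<Rightarrow> (nat \<Rightarrow> private_data) \<Rightarrow> history" where
  "honest_view \<Lambda> T L v r w =
     run (length L) (\<lambda>j. fst (\<Lambda> T L j (if j = 0 then v else w j))) r 0"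

definition posterior :: "algorithm \<Rightarrow> task \<Rightarrow> nat list \<Rightarrow> private_data \<Rightarrow> nat \<Rightarrow> history \<Rightarrow> (nat \<Rightarrow> private_data) pmf" where
  "posterior \<Lambda> T L v r h =
     cond_pmf (pmf_of_set ({1..<length L} \<rightarrow>\<^sub>E privates T)) {w. honest_view \<Lambda> T L v r w = h}"

definition switch :: "nat \<Rightarrow> strategy \<Rightarrow> strategy \<Rightarrow> strategy" where
  "switch r S S' = ((\<lambda>h. if length h < r then fst S h else fst S' h), snd S')"

definition outcome_from ::
  "algorithm \<Rightarrow> task \<Rightarrow> nat list \<Rightarrow> private_data \<Rightarrow> nat \<Rightarrow> history \<Rightarrow> strategy pmf \<Rightarrow> nat option list pmf" where
  "outcome_from \<Lambda> T L v r h D =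
     do {
       w \<leftarrow> posterior \<Lambda> T L v r h;
       S \<leftarrow> D;
       return_pmf (outputs \<Lambda> T (length L) L (switch r (\<Lambda> T L 0 v) S) w)
     }"

abbreviation expected_utility :: "nat \<Rightarrow> nat option list pmf \<Rightarrow> real" where
  "expected_utility p \<O> \<equiv> measure_pmf.expectation \<O> (utility p)"


section \<open>Equilibria\<close>

text \<open>A deviation at some round is an arbitrary change of the agent's strategy from that round on.\<close>

definition initial_equilibrium :: "algorithm \<Rightarrow> nat \<Rightarrow> nat \<Rightarrow> nat set \<Rightarrow> task \<Rightarrow> bool" where
  "initial_equilibrium \<Lambda> \<alpha> \<beta> Ids T \<longleftrightarrow>
     (\<forall>me\<in>Ids. \<forall>x\<in>inputs T. \<forall>p P. valid_plan Ids P \<longrightarrow>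
        expected_utility p (initial_outcome \<Lambda> \<alpha> \<beta> Ids T (honest_plan \<Lambda> T me x))
        \<ge> expected_utility p (initial_outcome \<Lambda> \<alpha> \<beta> Ids T P))"

definition later_equilibrium :: "algorithm \<Rightarrow> nat \<Rightarrow> nat \<Rightarrow> nat set \<Rightarrow> task \<Rightarrow> bool" where
  "later_equilibrium \<Lambda> \<alpha> \<beta> Ids T \<longleftrightarrow>
     (\<forall>L. length L \<in> {\<alpha>..\<beta>} \<longrightarrow> distinct L \<longrightarrow> set L \<subseteq> Ids \<longrightarrow>
        (\<forall>v\<in>privates T. \<forall>p D. \<forall>r \<le> 2 * length L.
           \<forall>h \<in> honest_view \<Lambda> T L v r ` ({1..<length L} \<rightarrow>\<^sub>E privates T).
             expected_utility p (outcome_from \<Lambda> T L v r h (return_pmf (\<Lambda> T L 0 v)))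
             \<ge> expected_utility p (outcome_from \<Lambda> T L v r h D)))"

definition solves :: "algorithm \<Rightarrow> nat \<Rightarrow> nat \<Rightarrow> nat set \<Rightarrow> task \<Rightarrow> bool" where
  "solves \<Lambda> \<alpha> \<beta> Ids T \<longleftrightarrow>
     (\<forall>L w. length L \<in> {\<alpha>..\<beta>} \<longrightarrow> distinct L \<longrightarrow> set L \<subseteq> Ids \<longrightarrow> (\<forall>j<length L. w j \<in> privates T) \<longrightarrow>
        outputs \<Lambda> T (length L) L (\<Lambda> T L 0 (w 0)) w
        = replicate (length L) (Some (eval_fn T L (\<lambda>j. fst (w j)))))"

definition k_knowledge_sharing_equilibrium ::
  "algorithm \<Rightarrow> nat \<Rightarrow> nat \<Rightarrow> nat set \<Rightarrow> nat \<Rightarrow> bool" where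
  "k_knowledge_sharing_equilibrium \<Lambda> \<alpha> \<beta> Ids k \<longleftrightarrow>
     (\<forall>T. k_task k T \<longrightarrow>
        solves \<Lambda> \<alpha> \<beta> Ids T \<and> initial_equilibrium \<Lambda> \<alpha> \<beta> Ids T \<and> later_equilibrium \<Lambda> \<alpha> \<beta> Ids T)"

definition knowledge_sharing_equilibrium :: "algorithm \<Rightarrow> nat \<Rightarrow> nat \<Rightarrow> nat set \<Rightarrow> bool" where
  "knowledge_sharing_equilibrium \<Lambda> \<alpha> \<beta> Ids \<longleftrightarrow>
     (\<forall>k. k_knowledge_sharing_equilibrium \<Lambda> \<alpha> \<beta> Ids k)"

end

theory Submission
  imports Defs
begin

text \<open>A cheater simulates the agents \<open>0, \<dots>, e\<close> of a ring of \<open>N = n + e\<close> agents, and \<open>\<beta> \<le> 2 * \<alpha> - 1\<close> forces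
  \<open>e < n\<close>. Then each simulated agent has an honest target, so its input is fixed by the messages sent
  before round \<open>N\<close>: if no honest agent aborts, agent \<open>N - 1\<close>, which receives all inputs through honest
  agents only, uses exactly these inputs. On the other hand neither target of agent \<open>N - 1\<close> lies in the
  interior of the simulated block, so until it has sent its messages of round \<open>N - 1\<close> the cheater has
  seen at most one of the two shares of each transmission of agent \<open>N - 1\<close>. The input of agent \<open>N - 1\<close>
  is therefore still uniform when all others are committed, and Full Knowledge bounds the chance of
  success by that of honest play.

  If \<open>\<beta> \<ge> 2 * \<alpha>\<close>, the cheater simulates \<open>\<alpha> + 1\<close> agents and gambles on \<open>n = \<alpha>\<close>, that is \<open>N = 2 * n\<close>.
  Then both targets of agent \<open>0\<close> are simulated, and its input can be chosen after all others are
  known. This succeeds with probability at least \<open>1 / (\<beta> - \<alpha> + 1)\<close>, more than \<open>1 / k\<close> for large \<open>k\<close>.\<close>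

section \<open>Honest executions\<close>

text \<open>Hops from an agent to its target, clockwise and, in \<open>ccw_dist\<close>,
  counter-clockwise; for positive \<open>N\<close> they add up to \<open>N\<close>.\<close>

fun cw_dist :: "nat \<Rightarrow> side \<Rightarrow> nat" where
  "cw_dist N Near = 1"
| "cw_dist N Far = N - N div 2"

fun ccw_dist :: "nat \<Rightarrow> side \<Rightarrow> nat" where
  "ccw_dist N Near = N - 1"
| "ccw_dist N Far = N div 2"

lemma cw_dist_bounds: "2 \<le> N \<Longrightarrow> 1 \<le> cw_dist N s" "2 \<le> N \<Longrightarrow> cw_dist N s < N"
  by (cases s; simp)+

lemma ccw_dist_bounds: "2 \<le> N \<Longrightarrow> 1 \<le> ccw_dist N s" "2 \<le> N \<Longrightarrow> ccw_dist N s < N"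
  by (cases s; simp)+

lemma target_cw_dist: "target N s a = (a + cw_dist N s) mod N"
  by (cases s) simp_all

lemma target_ccw_dist: "2 \<le> N \<Longrightarrow> target N s a = (a + (N - ccw_dist N s)) mod N"
  by (cases s) simp_all

text \<open>Congruences become disjunctions of linear equations, so that positions on the ring can
  be left to \<open>linarith\<close>.\<close>

lemma mod_add_eq_iff: "a < N \<Longrightarrow> t \<le> N \<Longrightarrow> j < N \<Longrightarrow> (a + t) mod N = j \<longleftrightarrow> a + t = j \<or> a + t = j + N"
  for a t N j :: nat
  by (cases "a + t < N") (auto simp: le_mod_geq)

lemma neighbour_bounds:
  fixes j N :: nat
  assumes "2 \<le> N" "j < N"
  obtains c m where "(j + 1) mod N = c" "(j + N - 1) mod N = m" "c < N" "m < N"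
    "j + 1 = c \<or> j + 1 = c + N" "m + 1 = j \<or> m + 1 = j + N"
proof
  have *: "(j + N - 1) mod N < N" "(j + 1) mod N < N" "(j + N - 1) mod N = (j + (N - 1)) mod N" using assms by simp_all
  then show "(j + 1) mod N < N" "(j + N - 1) mod N < N" by simp_all
  show "j + 1 = (j + 1) mod N \<or> j + 1 = (j + 1) mod N + N"
    using mod_add_eq_iff[OF assms(2) _ *(2), of 1] assms by simp
  show "(j + N - 1) mod N + 1 = j \<or> (j + N - 1) mod N + 1 = j + N"
    using mod_add_eq_iff[OF assms(2) _ *(1), of "N - 1"] assms *(3) by auto
qed auto

text \<open>The closed form of what agent \<open>j\<close> sends clockwise at round \<open>t\<close>
  if all are honest with data \<open>V\<close>. A share moves one hop per round while the next agent
  is not its target, and is delivered at round \<open>N - 1\<close>; inputs start at round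
  \<open>N + 1\<close>.\<close>

definition cw_msg :: "nat \<Rightarrow> (nat \<Rightarrow> private_data) \<Rightarrow> nat \<Rightarrow> nat \<Rightarrow> msg" where
  "cw_msg N V j t =
     (if t + 1 < N then
        {Share a s (cw_value (V a) s) | a s. a < N \<and> (a + t) mod N = j \<and> t + 1 < cw_dist N s}
      else if t + 1 = N then
        {Share a s (cw_value (V a) s) | a s. a < N \<and> target N s a = (j + 1) mod N}
      else if N < t \<and> t < 2 * N then
        {Input a (fst (V a)) | a. a < N \<and> (a + (t - N - 1)) mod N = j}
      else {})"

text \<open>Adding \<open>N - t\<close> stands for \<open>t\<close> hops counter-clockwise.\<close>

definition ccw_msg :: "nat \<Rightarrow> (nat \<Rightarrow> private_data) \<Rightarrow> nat \<Rightarrow> nat \<Rightarrow> msg" where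
  "ccw_msg N V j t =
     (if t + 1 < N then
        {Share a s (ccw_value (V a) s) | a s. a < N \<and> (a + (N - t)) mod N = j \<and> t + 1 < ccw_dist N s}
      else if t + 1 = N then
        {Share a s (ccw_value (V a) s) | a s. a < N \<and> target N s a = (j + N - 1) mod N}
      else {})"

definition msg_pair :: "nat \<Rightarrow> (nat \<Rightarrow> private_data) \<Rightarrow> nat \<Rightarrow> nat \<Rightarrow> msg \<times> msg" where
  "msg_pair N V j u = (cw_msg N V ((j + N - 1) mod N) u, ccw_msg N V ((j + 1) mod N) u)"

text \<open>The inductive step for the closed form: if the neighbour behind \<open>j\<close> has
  sent it so far, then so does \<open>j\<close>.\<close>

lemma relay_cw:
  assumes N: "2 \<le> N" "j < N" "t < N"
  shows "relay N ((j + 1) mod N) {Share j s (cw_value (V j) s) | s. True}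
           (map (cw_msg N V ((j + N - 1) mod N)) [0..<t]) = cw_msg N V j t"
proof -
  note b = cw_dist_bounds[OF N(1)]
  obtain c m where cm: "(j + 1) mod N = c" "(j + N - 1) mod N = m" "c < N" "m < N"
    "j + 1 = c \<or> j + 1 = c + N" "m + 1 = j \<or> m + 1 = j + N"
    using neighbour_bounds[OF N(1,2)] .
  show ?thesis
  proof (cases "t + 1 < N")
    case True
    show ?thesis
    proof (cases t)
      case 0
      have "target N s j \<noteq> (j + 1) mod N \<longleftrightarrow> 1 < cw_dist N s" for s
        using N b[of s] cm(3-) unfolding cm(1) target_cw_dist by (auto simp: mod_add_eq_iff)
      then show ?thesis using 0 True N by (auto simp: relay_def cw_msg_def)
    next
      case (Suc u)
      have l: "last (map (cw_msg N V ((j + N - 1) mod N)) [0..<t]) = cw_msg N V ((j + N - 1) mod N) u"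
        by (simp add: Suc)
      have iff: "((a + u) mod N = (j + N - 1) mod N \<and> u + 1 < cw_dist N s \<and> target N s a \<noteq> (j + 1) mod N)
        \<longleftrightarrow> ((a + t) mod N = j \<and> t + 1 < cw_dist N s)" if "a < N" for a s
      proof -
        define D where "D = cw_dist N s"
        have D: "1 \<le> D" "D < N" using b[of s] N unfolding D_def by auto
        have "(a + u) mod N = m \<longleftrightarrow> a + u = m \<or> a + u = m + N"
          "(a + t) mod N = j \<longleftrightarrow> a + t = j \<or> a + t = j + N"
          "(a + D) mod N = c \<longleftrightarrow> a + D = c \<or> a + D = c + N"
          by (rule mod_add_eq_iff; use D N that True Suc cm in linarith)+
        moreover have "((a + u = m \<or> a + u = m + N) \<and> u + 1 < D \<and> \<not> (a + D = c \<or> a + D = c + N))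
            \<longleftrightarrow> ((a + t = j \<or> a + t = j + N) \<and> t + 1 < D)"
          using D that True Suc cm(3-) by (elim disjE) (intro iffI conjI; elim conjE disjE; linarith)+
        ultimately show ?thesis unfolding cm(1,2) target_cw_dist D_def[symmetric] by blast
      qed
      show ?thesis
        unfolding relay_def l using True Suc iff
        by (simp add: cw_msg_def) blast
    qed
  next
    case False
    then have t: "t + 1 = N" using N by simp
    \<comment> \<open>Such a share needs \<open>cw_dist N s - 1\<close> hops to get here, the first
      at round \<open>0\<close>; so it came in at round \<open>cw_dist N s - 2\<close> and has been
      waiting at \<open>j\<close>.\<close>
    have le: "(\<exists>u<t. (a + u) mod N = (j + N - 1) mod N \<and> u + 1 < cw_dist N s) \<or> a = j"
      if "a < N" "target N s a = (j + 1) mod N" for a s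
    proof (cases "a = j")
      case False
      then have "(a + (cw_dist N s - 2)) mod N = (j + N - 1) mod N \<and> cw_dist N s - 2 + 1 < cw_dist N s"
        using N b[of s] that cm(3-) unfolding cm(1,2) target_cw_dist
        by (auto simp: mod_add_eq_iff)
      moreover have "cw_dist N s - 2 < t" using t b[of s] N by linarith
      ultimately show ?thesis by blast
    qed simp
    have "{Share a s y | a s y. Share a s y \<in> {Share j s (cw_value (V j) s) | s. True} \<union>
             \<Union> (cw_msg N V ((j + N - 1) mod N) ` {0..<t}) \<and> target N s a = (j + 1) mod N}
        = {Share a s (cw_value (V a) s) | a s. a < N \<and> target N s a = (j + 1) mod N}"
      (is "?A = ?B")
    proof
      show "?A \<subseteq> ?B" using t N(2) by (auto simp: cw_msg_def)
      show "?B \<subseteq> ?A"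
      proof
        fix z assume "z \<in> ?B"
        then obtain a s where z: "z = Share a s (cw_value (V a) s)" "a < N" "target N s a = (j + 1) mod N"
          by blast
        from le[OF z(2,3)] show "z \<in> ?A"
        proof
          assume "\<exists>u<t. (a + u) mod N = (j + N - 1) mod N \<and> u + 1 < cw_dist N s"
          then obtain u where "u < t" "(a + u) mod N = (j + N - 1) mod N" "u + 1 < cw_dist N s" by blast
          then have "z \<in> cw_msg N V ((j + N - 1) mod N) u"
            using z t by (auto simp: cw_msg_def)
          then show ?thesis using \<open>u < t\<close> z by auto
        qed (use z in auto)
      qed
    qed
    then show ?thesis using t by (auto simp: relay_def cw_msg_def)
  qed
qed

text \<open>The mirror image of \<open>relay_cw\<close>. Truncated differences get names that are
  characterised by sums, which keeps the arithmetic linear.\<close>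

lemma relay_ccw:
  assumes N: "2 \<le> N" "j < N" "t < N"
  shows "relay N ((j + N - 1) mod N) {Share j s (ccw_value (V j) s) | s. True}
           (map (ccw_msg N V ((j + 1) mod N)) [0..<t]) = ccw_msg N V j t"
proof -
  note b = ccw_dist_bounds[OF N(1)]
  obtain c m where cm: "(j + 1) mod N = c" "(j + N - 1) mod N = m" "c < N" "m < N"
    "j + 1 = c \<or> j + 1 = c + N" "m + 1 = j \<or> m + 1 = j + N"
    using neighbour_bounds[OF N(1,2)] .
  show ?thesis
  proof (cases "t + 1 < N")
    case True
    show ?thesis
    proof (cases t)
      case 0
      have "target N s j \<noteq> (j + N - 1) mod N \<longleftrightarrow> 1 < ccw_dist N s" for s
        using N b[of s] cm(3-) mod_add_eq_iff[OF N(2) _ cm(4), of "N - ccw_dist N s"]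
        unfolding cm(2) target_ccw_dist[OF N(1)] by auto
      then show ?thesis using 0 True N by (auto simp: relay_def ccw_msg_def)
    next
      case (Suc u)
      have l: "last (map (ccw_msg N V ((j + 1) mod N)) [0..<t]) = ccw_msg N V ((j + 1) mod N) u"
        by (simp add: Suc)
      have iff: "((a + (N - u)) mod N = (j + 1) mod N \<and> u + 1 < ccw_dist N s \<and> target N s a \<noteq> (j + N - 1) mod N)
        \<longleftrightarrow> ((a + (N - t)) mod N = j \<and> t + 1 < ccw_dist N s)" if "a < N" for a s
      proof -
        define D where "D = ccw_dist N s"
        define E where "E = N - D"
        have D: "1 \<le> D" "D < N" "E + D = N" using N b[of s] unfolding D_def E_def by auto
        define F where "F = N - u"
        define G where "G = N - t"
        have FG: "F + u = N" "G + t = N" using True Suc unfolding F_def G_def by auto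
        have "(a + F) mod N = c \<longleftrightarrow> a + F = c \<or> a + F = c + N"
          "(a + G) mod N = j \<longleftrightarrow> a + G = j \<or> a + G = j + N"
          "(a + E) mod N = m \<longleftrightarrow> a + E = m \<or> a + E = m + N"
          by (rule mod_add_eq_iff; use D FG N that True Suc cm in linarith)+
        moreover have "((a + F = c \<or> a + F = c + N) \<and> u + 1 < D \<and> \<not> (a + E = m \<or> a + E = m + N))
            \<longleftrightarrow> ((a + G = j \<or> a + G = j + N) \<and> t + 1 < D)"
          using D FG that True Suc cm(3-) by (elim disjE) (intro iffI conjI; elim conjE disjE; linarith)+
        ultimately show ?thesis
          unfolding cm(1,2) target_ccw_dist[OF N(1)] D_def[symmetric] E_def[symmetric]
            F_def[symmetric] G_def[symmetric] by blast
      qed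
      show ?thesis
        unfolding relay_def l using True Suc iff
        by (simp add: ccw_msg_def) blast
    qed
  next
    case False
    then have t: "t + 1 = N" using N by simp
    have le: "(\<exists>u<t. (a + (N - u)) mod N = (j + 1) mod N \<and> u + 1 < ccw_dist N s) \<or> a = j"
      if "a < N" "target N s a = (j + N - 1) mod N" for a s
    proof (cases "a = j")
      case False
      define D where "D = ccw_dist N s"
      define E where "E = N - D"
      have D: "1 \<le> D" "D < N" "E + D = N" using N b[of s] unfolding D_def E_def by auto
      have "a + E = m \<or> a + E = m + N"
        using that(2) mod_add_eq_iff[OF that(1) _ cm(4), of E] D
        unfolding cm(2) target_ccw_dist[OF N(1)] D_def[symmetric] E_def[symmetric] by linarith
      then have "2 \<le> D \<and> (a + (E + 2) = c \<or> a + (E + 2) = c + N)"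
        using D that N cm(3-) False by linarith
      moreover have "N - (D - 2) = E + 2" using D calculation by linarith
      ultimately have "(a + (N - (ccw_dist N s - 2))) mod N = (j + 1) mod N \<and> ccw_dist N s - 2 + 1 < ccw_dist N s"
        using mod_add_eq_iff[OF that(1) _ cm(3), of "E + 2"] D
        unfolding cm(1) D_def[symmetric] by auto
      moreover have "ccw_dist N s - 2 < t" using t b[of s] N by linarith
      ultimately show ?thesis by blast
    qed simp
    have "{Share a s y | a s y. Share a s y \<in> {Share j s (ccw_value (V j) s) | s. True} \<union>
             \<Union> (ccw_msg N V ((j + 1) mod N) ` {0..<t}) \<and> target N s a = (j + N - 1) mod N}
        = {Share a s (ccw_value (V a) s) | a s. a < N \<and> target N s a = (j + N - 1) mod N}"
      (is "?A = ?B")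
    proof
      show "?A \<subseteq> ?B" using t N(2) by (auto simp: ccw_msg_def)
      show "?B \<subseteq> ?A"
      proof
        fix z assume "z \<in> ?B"
        then obtain a s where z: "z = Share a s (ccw_value (V a) s)" "a < N" "target N s a = (j + N - 1) mod N"
          by blast
        from le[OF z(2,3)] show "z \<in> ?A"
        proof
          assume "\<exists>u<t. (a + (N - u)) mod N = (j + 1) mod N \<and> u + 1 < ccw_dist N s"
          then obtain u where "u < t" "(a + (N - u)) mod N = (j + 1) mod N" "u + 1 < ccw_dist N s" by blast
          then have "z \<in> ccw_msg N V ((j + 1) mod N) u"
            using z t by (auto simp: ccw_msg_def)
          then show ?thesis using \<open>u < t\<close> z by auto
        qed (use z in auto)
      qed
    qed
    then show ?thesis using t by (auto simp: relay_def ccw_msg_def)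
  qed
qed

lemma ring_behaviour_honest:
  assumes N: "2 \<le> N" "j < N"
  shows "ring_behaviour N j (V j) (map (msg_pair N V j) [0..<t]) = (cw_msg N V j t, ccw_msg N V j t)"
proof -
  have m: "map fst (map (msg_pair N V j) [0..<t]) = map (cw_msg N V ((j + N - 1) mod N)) [0..<t]"
    "map snd (map (msg_pair N V j) [0..<t]) = map (ccw_msg N V ((j + 1) mod N)) [0..<t]"
    by (simp_all add: msg_pair_def)
  obtain c m where cm: "(j + 1) mod N = c" "(j + N - 1) mod N = m" "c < N" "m < N"
    "j + 1 = c \<or> j + 1 = c + N" "m + 1 = j \<or> m + 1 = j + N"
    using neighbour_bounds[OF N(1,2)] .
  consider "t < N" | "t = N" | "t = N + 1" | "N + 1 < t" "t < 2 * N" | "N + 1 < t" "2 * N \<le> t"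
    by linarith
  then show ?thesis
  proof cases
    case 1
    then show ?thesis
      unfolding ring_behaviour_def Let_def m using relay_cw[OF N] relay_ccw[OF N] by simp
  next
    case 2
    then show ?thesis using N by (simp add: ring_behaviour_def cw_msg_def ccw_msg_def)
  next
    case 3
    then show ?thesis using N by (auto simp: ring_behaviour_def cw_msg_def ccw_msg_def)
  next
    case 4
    then obtain u where u: "t = Suc u" "N < u" by (cases t) auto
    have l: "last (map (msg_pair N V j) [0..<t]) = msg_pair N V j u" by (simp add: u)
    \<comment> \<open>An agent that passes on an input before round \<open>2 * N\<close> is not yet
      the one just before its origin, so the stopping test lets every input through.\<close>
    have iff: "((a + (u - N - 1)) mod N = (j + N - 1) mod N \<and> a \<noteq> (j + 1) mod N)
       \<longleftrightarrow> (a + (t - N - 1)) mod N = j" if "a < N" for a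
    proof -
      define x where "x = u - N - 1"
      have x: "x + N + 1 = u" "t - N - 1 = x + 1" "x + 2 < N" using 4 u by (auto simp: x_def)
      have "(a + x) mod N = m \<longleftrightarrow> a + x = m \<or> a + x = m + N"
        "(a + (x + 1)) mod N = j \<longleftrightarrow> a + (x + 1) = j \<or> a + (x + 1) = j + N"
        by (rule mod_add_eq_iff; use N that x cm in linarith)+
      moreover have "((a + x = m \<or> a + x = m + N) \<and> a \<noteq> c)
          \<longleftrightarrow> (a + (x + 1) = j \<or> a + (x + 1) = j + N)"
        using that x cm(3-) by (elim disjE) (intro iffI conjI; elim conjE disjE; linarith)+
      ultimately show ?thesis unfolding cm(1,2) x(2) x_def[symmetric] by blast
    qed
    have "{Input a x |a x. Input a x \<in> cw_msg N V ((j + N - 1) mod N) u \<and> a \<noteq> (j + 1) mod N} = cw_msg N V j t"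
      using 4 u iff by (simp add: cw_msg_def) blast
    then show ?thesis
      unfolding ring_behaviour_def Let_def l using 4 by (simp add: ccw_msg_def msg_pair_def)
  next
    case 5
    then show ?thesis using N by (simp add: ring_behaviour_def cw_msg_def ccw_msg_def)
  qed
qed

lemma honest_run:
  assumes "2 \<le> N" "j < N"
  shows "run N (\<lambda>i. ring_behaviour N i (V i)) t j = map (msg_pair N V j) [0..<t]"
  using assms(2)
proof (induction t arbitrary: j)
  case (Suc t)
  have nb: "(j + N - 1) mod N < N" "(j + 1) mod N < N" using assms(1) by simp_all
  show ?case
    unfolding run.simps Let_def Suc.IH[OF Suc.prems] Suc.IH[OF nb(1)] Suc.IH[OF nb(2)]
      ring_behaviour_honest[OF assms(1) nb(1)] ring_behaviour_honest[OF assms(1) nb(2)]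
    by (simp add: msg_pair_def)
qed simp

section \<open>What an honest agent receives and outputs\<close>

lemma Input_in_cw_msg:
  "Input a x \<in> cw_msg N V j t \<longleftrightarrow>
     N < t \<and> t < 2 * N \<and> a < N \<and> x = fst (V a) \<and> (a + (t - N - 1)) mod N = j"
  by (auto simp: cw_msg_def)

lemma Share_in_last_cw_msg:
  "2 \<le> N \<Longrightarrow> Share a s y \<in> cw_msg N V j (N - 1) \<longleftrightarrow>
     a < N \<and> y = cw_value (V a) s \<and> target N s a = (j + 1) mod N"
  by (auto simp: cw_msg_def)

lemma Share_in_last_ccw_msg:
  "2 \<le> N \<Longrightarrow> Share a s y \<in> ccw_msg N V j (N - 1) \<longleftrightarrow>
     a < N \<and> y = ccw_value (V a) s \<and> target N s a = (j + N - 1) mod N"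
  by (auto simp: ccw_msg_def)

text \<open>The input of \<open>i\<close> needs \<open>d\<close> hops to the neighbour behind
  \<open>j\<close>, which hands it over at round \<open>N + 1 + d\<close>, before round
  \<open>2 * N\<close>. Hence the \<open>THE\<close> in \<open>known_input\<close> is well
  defined.\<close>

lemma Input_received_honest:
  assumes N: "2 \<le> N" "j < N" "i < N" "i \<noteq> j"
  shows "(\<exists>m\<in>set (map (msg_pair N V j) [0..<2 * N]). Input i x \<in> fst m) \<longleftrightarrow> x = fst (V i)"
proof -
  obtain c m where cm: "(j + 1) mod N = c" "(j + N - 1) mod N = m" "c < N" "m < N"
    "j + 1 = c \<or> j + 1 = c + N" "m + 1 = j \<or> m + 1 = j + N"
    using neighbour_bounds[OF N(1,2)] .
  obtain d where d: "d < N - 1" "i + d = m \<or> i + d = m + N"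
  proof (cases "i \<le> m")
    case True
    then show ?thesis using that[of "m - i"] cm(3-) N by auto
  next
    case False
    then show ?thesis using that[of "m + N - i"] cm(3-) N by auto
  qed
  then have "(i + d) mod N = m" using mod_add_eq_iff[OF N(3) _ cm(4), of d] by simp
  then have "Input i (fst (V i)) \<in> fst (msg_pair N V j (N + 1 + d))" "N + 1 + d < 2 * N"
    using d N cm by (auto simp: msg_pair_def Input_in_cw_msg)
  then show ?thesis
    by (auto simp: msg_pair_def Input_in_cw_msg image_iff Bex_def intro!: exI[of _ "N + 1 + d"])
qed

lemma known_input_honest:
  assumes "2 \<le> N" "j < N" "i < N"
  shows "known_input j (V j) (map (msg_pair N V j) [0..<2 * N]) i = fst (V i)"
proof (cases "i = j")
  case False
  show ?thesis
    unfolding known_input_def Input_received_honest[OF assms False] using False by simp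
qed (simp add: known_input_def)

lemma eval_fn_cong: "(\<And>i. i < length L \<Longrightarrow> X i = Y i) \<Longrightarrow> eval_fn T L X = eval_fn T L Y"
  by (auto simp: eval_fn_def intro!: arg_cong[of _ _ "fn T"])

lemma ring_output_honest:
  assumes "2 \<le> length L" "j < length L" "\<And>i. i < length L \<Longrightarrow> V i \<in> privates T"
  shows "ring_output T L j (V j) (map (msg_pair (length L) V j) [0..<2 * length L])
    = Some (eval_fn T L (\<lambda>i. fst (V i)))"
proof -
  have "no_deviation_detected T (length L) j (V j) (map (msg_pair (length L) V j) [0..<2 * length L])"
    unfolding no_deviation_detected_def
    by (rule exI[of _ V]) (use assms in \<open>simp add: honest_run\<close>)
  then show ?thesis
    using known_input_honest[OF assms(1,2), of _ V] by (auto simp: ring_output_def intro: eval_fn_cong)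
qed

text \<open>An accepting agent has seen an honest execution with some data \<open>V\<close>, and
  outputs the value of that execution. Different agents may have different \<open>V\<close>; they
  are reconciled in \<open>accepted_output\<close>.\<close>

lemma ring_outputE:
  assumes "ring_output T L j v H = Some p" "2 \<le> length L" "j < length L"
  obtains V where "V j = v" "\<And>i. i < length L \<Longrightarrow> V i \<in> privates T"
    "H = map (msg_pair (length L) V j) [0..<2 * length L]" "p = eval_fn T L (\<lambda>i. fst (V i))"
proof -
  have nd: "no_deviation_detected T (length L) j v H" using assms(1) by (simp add: ring_output_def split: if_splits)
  then obtain V where V: "V j = v" "\<And>i. i < length L \<Longrightarrow> V i \<in> privates T"
    "H = map (msg_pair (length L) V j) [0..<2 * length L]"
    unfolding no_deviation_detected_def honest_run[OF assms(2,3)] by blast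
  have "p = eval_fn T L (\<lambda>i. fst (V i))"
    using ring_output_honest[OF assms(2,3) V(2), of "\<lambda>i. i"] V(1,3) assms(1) by simp
  with V that show ?thesis by blast
qed

section \<open>Executions with a duplicated agent\<close>

text \<open>Position \<open>j > 0\<close> on the real ring of \<open>n\<close> agents has index \<open>j + e\<close> on the ring of \<open>n + e\<close> agents,
  whose indices \<open>0, \<dots>, e\<close> all belong to position \<open>0\<close>.\<close>

definition sybil_behaviour :: "nat \<Rightarrow> nat \<Rightarrow> strategy \<Rightarrow> (nat \<Rightarrow> private_data) \<Rightarrow> nat \<Rightarrow> behaviour" where
  "sybil_behaviour n e S w j = (if j = 0 then fst S else ring_behaviour (n + e) (j + e) (w j))"

definition seen :: "nat \<Rightarrow> nat \<Rightarrow> strategy \<Rightarrow> (nat \<Rightarrow> private_data) \<Rightarrow> nat \<Rightarrow> nat \<Rightarrow> history" where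
  "seen n e S w t j = run n (sybil_behaviour n e S w) t j"

definition sent :: "nat \<Rightarrow> nat \<Rightarrow> strategy \<Rightarrow> (nat \<Rightarrow> private_data) \<Rightarrow> nat \<Rightarrow> nat \<Rightarrow> msg \<times> msg" where
  "sent n e S w t j = sybil_behaviour n e S w j (seen n e S w t j)"

lemma seen_conv:
  "seen n e S w t j = map (\<lambda>u. (fst (sent n e S w u ((j + n - 1) mod n)), snd (sent n e S w u ((j + 1) mod n)))) [0..<t]"
  by (induction t) (simp_all add: seen_def sent_def Let_def)

lemma pred_mod: "1 \<le> j \<Longrightarrow> j < N \<Longrightarrow> (j + N - 1) mod N = j - 1" for j N :: nat
  by (simp add: le_mod_geq)

lemma seen_honest_conv:
  "1 \<le> j \<Longrightarrow> j < n \<Longrightarrow> seen n e S w t j = map (\<lambda>u. (fst (sent n e S w u (j - 1)), snd (sent n e S w u ((j + 1) mod n)))) [0..<t]"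
  by (simp only: seen_conv pred_mod)

lemma outputs_ring_protocol:
  assumes "length L = n + e"
  shows "outputs ring_protocol T n L S w =
    map (\<lambda>j. if j = 0 then snd S (seen n e S w (2 * (n + e)) 0)
             else ring_output T L (j + e) (w j) (seen n e S w (2 * (n + e)) j)) [0..<n]"
proof -
  have "(\<lambda>j. fst (if j = 0 then S else ring_protocol T L (j + (n + e - n)) (w j))) = sybil_behaviour n e S w"
    by (auto simp: sybil_behaviour_def ring_protocol_def assms)
  then show ?thesis
    unfolding outputs_def assms seen_def Let_def by (auto simp: ring_protocol_def)
qed

context
  fixes n e :: nat and S :: strategy and w :: "nat \<Rightarrow> private_data"
  assumes n: "2 \<le> n"
begin

text \<open>The two directions of travel do not interact at an honest agent, so its messages are
  described for each direction and for early and last rounds of the share phase separately.\<close>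

lemma cw_sent:
  assumes "1 \<le> j" "j < n" "t + 1 < n + e"
  shows "fst (sent n e S w t j) =
    {Share a s y | a s y. Share a s y \<in> (if t = 0 then {Share (j + e) s (cw_value (w j) s) | s. True}
                                         else fst (sent n e S w (t - 1) (j - 1)))
       \<and> target (n + e) s a \<noteq> (j + e + 1) mod (n + e)}"
  using assms
  by (cases t; subst sent_def; simp add: sybil_behaviour_def ring_behaviour_def seen_honest_conv relay_def Let_def)

lemma ccw_sent:
  assumes "1 \<le> j" "j < n" "t + 1 < n + e"
  shows "snd (sent n e S w t j) =
    {Share a s y | a s y. Share a s y \<in> (if t = 0 then {Share (j + e) s (ccw_value (w j) s) | s. True}
                                         else snd (sent n e S w (t - 1) ((j + 1) mod n)))
       \<and> target (n + e) s a \<noteq> j + e - 1}"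
proof -
  have "(j + e + (n + e) - 1) mod (n + e) = j + e - 1" using assms by (intro pred_mod) simp_all
  then show ?thesis using assms
    by (cases t; subst sent_def; simp add: sybil_behaviour_def ring_behaviour_def seen_honest_conv relay_def Let_def)
qed

lemma cw_sent_last:
  assumes "1 \<le> j" "j < n" "t + 1 = n + e"
  shows "fst (sent n e S w t j) =
    {Share a s y | a s y. Share a s y \<in> {Share (j + e) s (cw_value (w j) s) | s. True} \<union> (\<Union>u<t. fst (sent n e S w u (j - 1)))
       \<and> target (n + e) s a = (j + e + 1) mod (n + e)}"
  using assms
  by (simp add: sent_def[of n e S w t] sybil_behaviour_def ring_behaviour_def seen_honest_conv relay_def Let_def
      atLeast0LessThan)

lemma ccw_sent_last:
  assumes "1 \<le> j" "j < n" "t + 1 = n + e"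
  shows "snd (sent n e S w t j) =
    {Share a s y | a s y. Share a s y \<in> {Share (j + e) s (ccw_value (w j) s) | s. True} \<union> (\<Union>u<t. snd (sent n e S w u ((j + 1) mod n)))
       \<and> target (n + e) s a = j + e - 1}"
proof -
  have "(j + e + (n + e) - 1) mod (n + e) = j + e - 1" using assms by (intro pred_mod) simp_all
  then show ?thesis using assms
    by (simp add: sent_def[of n e S w t] sybil_behaviour_def ring_behaviour_def seen_honest_conv relay_def Let_def
      atLeast0LessThan)
qed

lemma own_input_sent:
  "1 \<le> j \<Longrightarrow> j < n \<Longrightarrow> Input (j + e) (fst (w j)) \<in> fst (sent n e S w (n + e + 1) j)"
  by (simp add: sent_def sybil_behaviour_def ring_behaviour_def seen_honest_conv)

text \<open>Inputs travel clockwise only, and the positions after \<open>j\<close> that relay them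
  are honest. By \<open>a \<le> j + e\<close> the index of the next agent always exceeds
  \<open>a\<close>, so the stopping test does not interfere.\<close>

lemma input_relayed:
  assumes "Input a y \<in> fst (sent n e S w u j)" "n + e + 1 \<le> u" "u + m < 2 * (n + e)" "j + m + 1 < n" "a \<le> j + e"
  shows "Input a y \<in> fst (sent n e S w (u + m) (j + m))"
  using assms(3,4)
proof (induction m)
  case (Suc m)
  then have "Input a y \<in> fst (sent n e S w (u + m) (j + m))" by simp
  moreover have "fst (sent n e S w (Suc (u + m)) (Suc (j + m))) =
    {Input a x | a x. Input a x \<in> fst (sent n e S w (u + m) (j + m)) \<and> a \<noteq> j + m + e + 2}"
    using Suc.prems assms(2)
    by (subst sent_def) (simp add: sybil_behaviour_def ring_behaviour_def seen_honest_conv Let_def)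
  ultimately show ?case using assms(5) by simp
qed (use assms(1) in simp)

end

section \<open>Commitment of the simulated agents\<close>

text \<open>For \<open>e < n\<close> the simulated agent \<open>c\<close> has an honest target: its clockwise neighbour if \<open>c = e\<close>, and
  its far target otherwise.\<close>

definition commit_side :: "nat \<Rightarrow> nat \<Rightarrow> side" where
  "commit_side e c = (if c = e then Near else Far)"

definition commit_pos :: "nat \<Rightarrow> nat \<Rightarrow> nat \<Rightarrow> nat" where
  "commit_pos n e c = (if c = e then 1 else c + (n + e - (n + e) div 2) - e)"

text \<open>The input of the simulated agent \<open>c\<close> as read off the two shares that the
  neighbours of its target send at round \<open>N - 1\<close>, where \<open>N = n + e\<close>. The
  cheater may be one of these neighbours. If a share is missing or ambiguous, the value is
  arbitrary.\<close>

definition commit :: "nat \<Rightarrow> nat \<Rightarrow> strategy \<Rightarrow> (nat \<Rightarrow> private_data) \<Rightarrow> nat \<Rightarrow> nat" where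
  "commit n e S w c =
     Bit_Operations.xor
       (THE y. Share c (commit_side e c) y \<in> fst (sent n e S w (n + e - 1) (commit_pos n e c - 1)))
       (THE y. Share c (commit_side e c) y \<in> snd (sent n e S w (n + e - 1) ((commit_pos n e c + 1) mod n)))"

definition committed :: "nat \<Rightarrow> nat \<Rightarrow> strategy \<Rightarrow> (nat \<Rightarrow> private_data) \<Rightarrow> nat \<Rightarrow> nat" where
  "committed n e S w i = (if i \<le> e then commit n e S w i else fst (w (i - e)))"

text \<open>With \<open>N = n + e\<close>, \<open>e < n\<close> gives
  \<open>e < N - N div 2 \<le> n\<close>: the far target of \<open>c < e\<close> lies beyond the
  block and before the ring closes. For \<open>c = e\<close> it may wrap around to index
  \<open>0\<close>, hence the near target.\<close>

lemma commit_pos: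
  assumes "2 \<le> n" "e < n" "c \<le> e"
  shows "1 \<le> commit_pos n e c" "commit_pos n e c < n"
    "target (n + e) (commit_side e c) c = commit_pos n e c + e"
proof -
  show *: "1 \<le> commit_pos n e c" "commit_pos n e c < n"
    using assms unfolding commit_pos_def by (auto split: if_splits)
  show "target (n + e) (commit_side e c) c = commit_pos n e c + e"
  proof (cases "c = e")
    case False
    then have "c + (n + e - (n + e) div 2) = commit_pos n e c + e" using assms by (simp add: commit_pos_def)
    then show ?thesis using * False by (simp add: commit_side_def target_cw_dist)
  qed (use assms in \<open>simp add: commit_pos_def commit_side_def\<close>)
qed

lemma xor_shares: "Bit_Operations.xor (cw_value v s) (ccw_value v s) = fst v"
  by (simp add: ccw_value_def flip: xor.assoc)

text \<open>Each accepting position \<open>j\<close> explains its history by an assignment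
  \<open>VV j\<close> of its own. All are compared with \<open>V\<close>, the one of position
  \<open>n - 1\<close>, which is the last on the clockwise route from the cheater.\<close>

lemma accepted_output:
  assumes n: "2 \<le> n" "e < n" "length L = n + e"
    and acc: "\<And>j. 1 \<le> j \<Longrightarrow> j < n \<Longrightarrow> ring_output T L (j + e) (w j) (seen n e S w (2 * (n + e)) j) = Some p"
  shows "p = eval_fn T L (committed n e S w)" "\<And>i. i < n + e \<Longrightarrow> committed n e S w i \<in> inputs T"
proof -
  define N where "N = n + e"
  have N: "2 \<le> N" "length L = N" using n by (simp_all add: N_def)
  define ok where "ok j V \<longleftrightarrow> V (j + e) = w j \<and> (\<forall>i<N. V i \<in> privates T) \<and>
          seen n e S w (2 * (n + e)) j = map (msg_pair N V (j + e)) [0..<2 * N] \<and>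
          p = eval_fn T L (\<lambda>i. fst (V i))" for j V
  have "\<exists>V. ok j V" if "1 \<le> j" "j < n" for j
    unfolding ok_def by (rule ring_outputE[OF acc[OF that]]) (use n that N in \<open>auto simp: N_def\<close>)
  then have "\<forall>j. \<exists>V. 1 \<le> j \<and> j < n \<longrightarrow> ok j V" by blast
  from choice[OF this] obtain VV where "\<And>j. 1 \<le> j \<Longrightarrow> j < n \<Longrightarrow> ok j (VV j)" by blast
  then have VV: "VV j (j + e) = w j" "\<And>i. i < N \<Longrightarrow> VV j i \<in> privates T"
      "seen n e S w (2 * (n + e)) j = map (msg_pair N (VV j) (j + e)) [0..<2 * N]"
      "p = eval_fn T L (\<lambda>i. fst (VV j i))" if "1 \<le> j" "j < n" for j
    using that unfolding ok_def by simp_all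
  have m: "fst (sent n e S w u (j - 1)) = cw_msg N (VV j) (j + e - 1) u"
      "snd (sent n e S w u ((j + 1) mod n)) = ccw_msg N (VV j) ((j + e + 1) mod N) u"
    if "1 \<le> j" "j < n" "u < 2 * N" for j u
  proof -
    have "map (\<lambda>u. (fst (sent n e S w u (j - 1)), snd (sent n e S w u ((j + 1) mod n)))) [0..<2 * N] ! u
      = map (msg_pair N (VV j) (j + e)) [0..<2 * N] ! u"
      using VV(3)[OF that(1,2)] unfolding seen_honest_conv[OF that(1,2)] N_def by (rule arg_cong)
    moreover have "(j + e + N - 1) mod N = j + e - 1" using that by (intro pred_mod) (simp_all add: N_def)
    ultimately show "fst (sent n e S w u (j - 1)) = cw_msg N (VV j) (j + e - 1) u"
      "snd (sent n e S w u ((j + 1) mod n)) = ccw_msg N (VV j) ((j + e + 1) mod N) u"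
      using that by (simp_all add: msg_pair_def)
  qed
  define V where "V = VV (n - 1)"
  have last: "y = fst (V a)" if "Input a y \<in> fst (sent n e S w u (n - 2))" "u < 2 * N" for a y u
    using that m(1)[of "n - 1" u] n by (simp add: V_def Input_in_cw_msg numeral_2_eq_2)
  have honest: "fst (V i) = fst (w (i - e))" if "e < i" "i < N" for i
  proof (cases "i = N - 1")
    case True
    then show ?thesis using VV(1)[of "n - 1"] n by (simp add: V_def N_def)
  next
    case False
    have "Input i (fst (w (i - e))) \<in> fst (sent n e S w (N + 1) (i - e))"
      using own_input_sent[OF n(1), where j = "i - e" and e = e and S = S and w = w] that by (simp add: N_def)
    then have "Input i (fst (w (i - e))) \<in> fst (sent n e S w (N + 1 + (N - 2 - i)) (i - e + (N - 2 - i)))"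
      using that False by (intro input_relayed[OF n(1)]) (auto simp: N_def)
    moreover have "i - e + (N - 2 - i) = n - 2" using that False by (simp add: N_def)
    ultimately show ?thesis using last[of i _ "N + 1 + (N - 2 - i)"] that by simp
  qed
  \<comment> \<open>The target \<open>t\<close> of \<open>c\<close> reconstructs the committed value
    from the two shares and accepts only if the input announced later is the same. From
    \<open>t\<close> on, this announcement reaches position \<open>n - 1\<close> unaltered.\<close>
  have sybil: "fst (V c) = commit n e S w c" if c: "c \<le> e" for c
  proof -
    define t where "t = commit_pos n e c"
    note t = commit_pos[OF n(1,2) c, folded t_def N_def]
    have cN: "c < N" using c n by (simp add: N_def)
    have mt: "(t + e - 1 + 1) mod N = t + e" "((t + e + 1) mod N + N - 1) mod N = t + e"
    proof -
      have te: "t + e < N" using t by (simp add: N_def)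
      then show "(t + e - 1 + 1) mod N = t + e" using t by simp
      obtain c' where "(t + e + 1) mod N = c'" "c' < N" "t + e + 1 = c' \<or> t + e + 1 = c' + N"
        using neighbour_bounds[OF N(1) te] by metis
      then show "((t + e + 1) mod N + N - 1) mod N = t + e" using te by auto
    qed
    have sh: "Share c (commit_side e c) y \<in> fst (sent n e S w (N - 1) (t - 1)) \<longleftrightarrow> y = cw_value (VV t c) (commit_side e c)"
      "Share c (commit_side e c) y \<in> snd (sent n e S w (N - 1) ((t + 1) mod n)) \<longleftrightarrow> y = ccw_value (VV t c) (commit_side e c)" for y
      using t cN N mt by (simp_all add: m Share_in_last_cw_msg Share_in_last_ccw_msg del: One_nat_def)
    have "commit n e S w c = fst (VV t c)"
      unfolding commit_def N_def[symmetric] t_def[symmetric] sh by (simp add: xor_shares)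
    moreover have "fst (VV t c) = fst (V c)"
    proof -
      \<comment> \<open>An input starts at round \<open>N + 1\<close> and takes
        \<open>t + e - 1 - c\<close> hops to the agent just before the target.\<close>
      define u where "u = N + (t + e) - c"
      have u: "N + 1 \<le> u" "u < 2 * N" "c + (u - N - 1) = t + e - 1" "u + (n - 1 - t) < 2 * N"
        using t c by (auto simp: u_def N_def)
      have "Input c (fst (VV t c)) \<in> fst (sent n e S w u (t - 1))"
        unfolding m(1)[OF t(1,2) u(2)] Input_in_cw_msg u(3) using t u cN by (simp add: N_def)
      then have "Input c (fst (VV t c)) \<in> fst (sent n e S w (u + (n - 1 - t)) (t - 1 + (n - 1 - t)))"
        using t u c by (intro input_relayed[OF n(1)]) (auto simp: N_def)
      moreover have "t - 1 + (n - 1 - t) = n - 2" using t by simp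
      ultimately show ?thesis using last u by simp
    qed
    ultimately show ?thesis by simp
  qed
  have eq: "committed n e S w i = fst (V i)" if "i < N" for i
    using honest sybil that by (auto simp: committed_def)
  show "p = eval_fn T L (committed n e S w)"
    using VV(4)[of "n - 1"] n eq by (auto simp: V_def N intro: eval_fn_cong)
  show "committed n e S w i \<in> inputs T" if "i < n + e" for i
    using VV(2)[of "n - 1" i] n eq[of i] that by (auto simp: V_def N_def privates_def mem_Times_iff)
qed

section \<open>Secrecy of the last input\<close>

text \<open>With \<open>N = n + e\<close>, the far target of agent \<open>N - 1\<close> has index
  \<open>N - N div 2 - 1\<close>. Agent \<open>N - N div 2\<close>, just before it on the
  counter-clockwise route, holds the share back until round \<open>N - 1\<close>, so no agent up to
  that index sends it earlier.\<close>

lemma far_share_stopped: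
  assumes n: "2 \<le> n" "e < n"
    and "1 \<le> j" "j + e \<le> n + e - (n + e) div 2" "u + 1 < n + e"
  shows "Share (n + e - 1) Far y \<notin> snd (sent n e S w u j)"
  using assms(3-)
proof (induction u arbitrary: j)
  have j: "j < n" if "j + e \<le> n + e - (n + e) div 2" for j using that n by linarith
  have target: "target (n + e) Far (n + e - 1) = n + e - (n + e) div 2 - 1"
    using n by (simp add: le_mod_geq)
  {
    case 0
    show ?case
    proof
      assume "Share (n + e - 1) Far y \<in> snd (sent n e S w 0 j)"
      then have "n + e - 1 = j + e" "target (n + e) Far (n + e - 1) \<noteq> j + e - 1"
        using ccw_sent[OF n(1) 0(1) j[OF 0(2)] 0(3)] by (auto simp del: target.simps)
      then show False using target 0 n by linarith
    qed
  next
    case (Suc u)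
    show ?case
    proof (cases "j + e = n + e - (n + e) div 2")
      case True
      then show ?thesis using j[OF Suc.prems(2)] n target Suc.prems by (auto simp: ccw_sent)
    next
      case False
      then have "j + 1 < n" using Suc.prems n by linarith
      then have "Share (n + e - 1) Far y \<notin> snd (sent n e S w u ((j + 1) mod n))"
        using Suc.IH[of "j + 1"] Suc.prems False by simp
      then show ?thesis
        using ccw_sent[OF n(1) Suc.prems(1) j[OF Suc.prems(2)] Suc.prems(3)] by (auto simp del: target.simps)
    qed
  }
qed

lemma share_diff_cong:
  assumes "\<And>s. P i s \<Longrightarrow> f s = g s \<or> (\<forall>y. Share i s y \<in> F)"
  shows "{Share a s y | a s y. Share a s y \<in> {Share i s (f s) | s. True} \<and> P a s} - F
       = {Share a s y | a s y. Share a s y \<in> {Share i s (g s) | s. True} \<and> P a s} - F"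
proof -
  have *: "{Share a s y | a s y. Share a s y \<in> {Share i s (h s) | s. True} \<and> P a s} - F
      = (\<lambda>s. Share i s (h s)) ` {s. P i s \<and> Share i s (h s) \<notin> F}" for h
    by auto
  have "P i s \<and> Share i s (f s) \<notin> F \<longleftrightarrow> P i s \<and> Share i s (g s) \<notin> F" for s using assms[of s] by auto
  then show ?thesis unfolding * using assms by (intro image_cong) auto
qed

text \<open>Clockwise messages do not carry the near share of agent \<open>n + e - 1\<close> before the last round, as its
  near target is the next agent. Counter-clockwise messages may carry its far share, but this is
  stopped before the simulated block.\<close>

lemma hidden_input:
  fixes n e :: nat and S :: strategy and w w' :: "nat \<Rightarrow> private_data"
  assumes n: "2 \<le> n" "e < n"
    and w: "\<And>j. 1 \<le> j \<Longrightarrow> j < n - 1 \<Longrightarrow> w' j = w j"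
      "ccw_value (w' (n - 1)) Near = ccw_value (w (n - 1)) Near"
      "cw_value (w' (n - 1)) Far = cw_value (w (n - 1)) Far"
  shows seen_hidden_input: "\<And>t. t < n + e \<Longrightarrow> seen n e S w' t 0 = seen n e S w t 0"
    and commit_hidden_input: "\<And>c. c \<le> e \<Longrightarrow> commit n e S w' c = commit n e S w c"
proof -
  define N where "N = n + e"
  define F where "F = range (Share (N - 1) Far)"
  have seen_cong: "seen n e S w' u 0 = seen n e S w u 0"
    if eq: "\<And>v j. v < u \<Longrightarrow> j < n \<Longrightarrow> fst (sent n e S w' v j) = fst (sent n e S w v j)
        \<and> snd (sent n e S w' v j) - F = snd (sent n e S w v j) - F" and "u < N" for u
  proof -
    \<comment> \<open>The neighbour of the cheater sends no element of \<open>F\<close>, so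
      agreement up to \<open>F\<close> is full agreement for what the cheater receives.\<close>
    have "snd (sent n e S w' v 1) = snd (sent n e S w v 1)" if "v < u" for v
    proof -
      have "1 + e \<le> n + e - (n + e) div 2" using n by linarith
      then have "snd (sent n e S x v 1) \<inter> F = {}" for x
        using far_share_stopped[OF n, where j = 1 and u = v and S = S and w = x] \<open>v < u\<close> \<open>u < N\<close>
        by (auto simp: F_def N_def)
      moreover have "snd (sent n e S w' v 1) - F = snd (sent n e S w v 1) - F"
        using eq[OF \<open>v < u\<close>, of 1] n by simp
      ultimately show ?thesis by blast
    qed
    moreover have "fst (sent n e S w' v (n - 1)) = fst (sent n e S w v (n - 1))" if "v < u" for v
      using eq[OF that, of "n - 1"] n by simp
    ultimately show ?thesis using n by (simp add: seen_conv)
  qed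
  have main: "fst (sent n e S w' u j) = fst (sent n e S w u j)
        \<and> snd (sent n e S w' u j) - F = snd (sent n e S w u j) - F" if "u + 1 < N" "j < n" for u j
    using that
  \<comment> \<open>Strong induction, since the cheater reacts to its whole history; honest agents
    only react to the previous round here.\<close>
  proof (induction u arbitrary: j rule: less_induct)
    case (less u)
    show ?case
    proof (cases "j = 0")
      case True
      then show ?thesis
        using seen_cong[of u] less by (simp add: sent_def sybil_behaviour_def)
    next
      case False
      then have j: "1 \<le> j" "j < n" using less by auto
      show ?thesis
      proof (cases u)
        case 0
        show ?thesis
        proof (cases "j = n - 1")
          case True
          have jN: "j + e = N - 1" using True n by (auto simp: N_def)
          have "target (n + e) Near (j + e) = (j + e + 1) mod (n + e)" by simp
          then have cw: "cw_value (w' j) s = cw_value (w j) s \<or> (\<forall>y. Share (j + e) s y \<in> {})"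
            if "target (n + e) s (j + e) \<noteq> (j + e + 1) mod (n + e)" for s
            using that w(3) True by (cases s) auto
          have ccw: "ccw_value (w' j) s = ccw_value (w j) s \<or> (\<forall>y. Share (j + e) s y \<in> F)" for s
            using w(2) by (cases s) (simp_all add: F_def jN True[symmetric] del: One_nat_def)
          have "fst (sent n e S w' u j) - {} = fst (sent n e S w u j) - {}"
            unfolding cw_sent[OF n(1) j less.prems(1)[unfolded N_def]] if_P[OF 0]
            by (rule share_diff_cong) (rule cw)
          moreover have "snd (sent n e S w' u j) - F = snd (sent n e S w u j) - F"
            unfolding ccw_sent[OF n(1) j less.prems(1)[unfolded N_def]] if_P[OF 0]
            by (rule share_diff_cong) (rule ccw)
          ultimately show ?thesis by simp
        next
          case False
          then show ?thesis
            using w(1)[of j] j less.prems by (simp add: cw_sent[OF n(1)] ccw_sent[OF n(1)] N_def 0)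
        qed
      next
        case (Suc v)
        have "fst (sent n e S w' v (j - 1)) = fst (sent n e S w v (j - 1))"
          using less.IH[of v "j - 1"] less.prems Suc by simp
        moreover have "snd (sent n e S w' v ((j + 1) mod n)) - F = snd (sent n e S w v ((j + 1) mod n)) - F"
          using less.IH[of v "(j + 1) mod n"] less.prems Suc n by simp
        ultimately show ?thesis
          unfolding cw_sent[OF n(1) j less.prems(1)[unfolded N_def]]
               ccw_sent[OF n(1) j less.prems(1)[unfolded N_def]]
          using Suc by auto
      qed
    qed
  qed
  show seen: "seen n e S w' t 0 = seen n e S w t 0" if "t < n + e" for t
    using that main by (intro seen_cong) (auto simp: N_def)
  \<comment> \<open>The cheater acts at round \<open>N - 1\<close> on rounds already compared, and
    honest agents only pass on earlier shares of \<open>c \<le> e\<close>. These are never in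
    \<open>F\<close>, because \<open>e < N - 1\<close>.\<close>
  have commit_share: "Share c s y \<in> fst (sent n e S w' (N - 1) j) \<longleftrightarrow> Share c s y \<in> fst (sent n e S w (N - 1) j)"
    "Share c s y \<in> snd (sent n e S w' (N - 1) j) \<longleftrightarrow> Share c s y \<in> snd (sent n e S w (N - 1) j)"
    if c: "c \<le> e" "j < n" for c s y j
  proof -
    have cF: "Share c s y \<notin> F" using c n by (auto simp: F_def N_def)
    have t: "N - 1 + 1 = n + e" using n by (simp add: N_def)
    have "(Share c s y \<in> fst (sent n e S w' (N - 1) j) \<longleftrightarrow> Share c s y \<in> fst (sent n e S w (N - 1) j))
      \<and> (Share c s y \<in> snd (sent n e S w' (N - 1) j) \<longleftrightarrow> Share c s y \<in> snd (sent n e S w (N - 1) j))"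
    proof (cases "j = 0")
      case True
      then show ?thesis using seen[of "N - 1"] n by (simp add: sent_def sybil_behaviour_def N_def)
    next
      case False
      then have j: "1 \<le> j" "j < n" using c by auto
      have own: "c \<noteq> j + e" using j c by simp
      have "fst (sent n e S w' u (j - 1)) = fst (sent n e S w u (j - 1))" if "u < N - 1" for u
        using main[of u "j - 1"] that j by simp
      moreover have "Share c s y \<in> snd (sent n e S w' u ((j + 1) mod n)) \<longleftrightarrow> Share c s y \<in> snd (sent n e S w u ((j + 1) mod n))"
        if "u < N - 1" for u
      proof -
        have "snd (sent n e S w' u ((j + 1) mod n)) - F = snd (sent n e S w u ((j + 1) mod n)) - F"
          using main[of u "(j + 1) mod n"] that j by simp
        then show ?thesis using cF by blast
      qed
      ultimately show ?thesis
        unfolding cw_sent_last[OF n(1) j t] ccw_sent_last[OF n(1) j t] using own by auto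
    qed
    then show "Share c s y \<in> fst (sent n e S w' (N - 1) j) \<longleftrightarrow> Share c s y \<in> fst (sent n e S w (N - 1) j)"
    "Share c s y \<in> snd (sent n e S w' (N - 1) j) \<longleftrightarrow> Share c s y \<in> snd (sent n e S w (N - 1) j)" by blast+
  qed
  show "commit n e S w' c = commit n e S w c" if "c \<le> e" for c
    using commit_share[OF that] commit_pos[OF n that] unfolding commit_def N_def by simp
qed

section \<open>Counting\<close>

text \<open>Double counting: exchanging the stored value \<open>pr w\<close> with the new value
  \<open>x\<close> is an involution on pairs \<open>(w, x)\<close>.\<close>

lemma sum_card_refit:
  assumes "finite W" "finite I"
    and "\<And>w. w \<in> W \<Longrightarrow> pr w \<in> I" "\<And>w x. w \<in> W \<Longrightarrow> x \<in> I \<Longrightarrow> re w x \<in> W \<and> pr (re w x) = x"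
    and "\<And>w x. w \<in> W \<Longrightarrow> x \<in> I \<Longrightarrow> re (re w x) (pr w) = w"
  shows "(\<Sum>w\<in>W. card {x \<in> I. G (re w x)}) = card I * card {w \<in> W. G w}"
proof -
  have "(\<Sum>w\<in>W. card {x \<in> I. G (re w x)}) = card (SIGMA w:W. {x \<in> I. G (re w x)})"
    using assms by simp
  also have "\<dots> = card ({w \<in> W. G w} \<times> I)"
    by (rule bij_betw_same_card[of "\<lambda>(w, x). (re w x, pr w)"],
        rule bij_betwI[where g = "\<lambda>(w, x). (re w x, pr w)"]) (use assms in auto)
  finally show ?thesis by (simp add: card_cartesian_product)
qed

text \<open>Resampling \<open>pr w\<close> uniformly preserves the uniform distribution on
  \<open>W\<close>, so a bound that holds after resampling at every \<open>w\<close> holds on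
  average.\<close>

lemma averaging_le:
  fixes c :: real
  assumes "finite W" "finite I" "I \<noteq> {}"
    and "\<And>w. w \<in> W \<Longrightarrow> pr w \<in> I" "\<And>w x. w \<in> W \<Longrightarrow> x \<in> I \<Longrightarrow> re w x \<in> W \<and> pr (re w x) = x"
    and "\<And>w x. w \<in> W \<Longrightarrow> x \<in> I \<Longrightarrow> re (re w x) (pr w) = w"
    and le: "\<And>w. w \<in> W \<Longrightarrow> real (card {x \<in> I. G (re w x)}) \<le> c * card I"
  shows "real (card {w \<in> W. G w}) \<le> c * card W"
proof -
  have "real (card I) * card {w \<in> W. G w} = (\<Sum>w\<in>W. real (card {x \<in> I. G (re w x)}))"
    using arg_cong[OF sum_card_refit[of W I pr re G, OF assms(1,2,4-6)], of real] by simp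
  also have "\<dots> \<le> (\<Sum>w\<in>W. c * card I)" by (intro sum_mono le)
  also have "\<dots> = card I * (c * card W)" by simp
  finally show ?thesis using assms(2,3) by (simp add: card_gt_0_iff)
qed

lemma averaging_eq:
  fixes c :: real
  assumes "finite W" "finite I" "I \<noteq> {}"
    and "\<And>w. w \<in> W \<Longrightarrow> pr w \<in> I" "\<And>w x. w \<in> W \<Longrightarrow> x \<in> I \<Longrightarrow> re w x \<in> W \<and> pr (re w x) = x"
    and "\<And>w x. w \<in> W \<Longrightarrow> x \<in> I \<Longrightarrow> re (re w x) (pr w) = w"
    and eq: "\<And>w. w \<in> W \<Longrightarrow> real (card {x \<in> I. G (re w x)}) = c * card I"
  shows "real (card {w \<in> W. G w}) = c * card W"
proof -
  have "real (card I) * card {w \<in> W. G w} = (\<Sum>w\<in>W. real (card {x \<in> I. G (re w x)}))"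
    using arg_cong[OF sum_card_refit[of W I pr re G, OF assms(1,2,4-6)], of real] by simp
  also have "\<dots> = card I * (c * card W)" using eq by simp
  finally show ?thesis using assms(2,3) by (simp add: card_gt_0_iff)
qed

text \<open>Changes the input while preserving the two shares that may pass the cheater early.\<close>

definition refit :: "private_data \<Rightarrow> nat \<Rightarrow> private_data" where
  "refit v x = (x, Bit_Operations.xor (Bit_Operations.xor (fst (snd v)) (fst v)) x, snd (snd v))"

lemma refit_simps:
  "fst (refit v x) = x" "ccw_value (refit v x) Near = ccw_value v Near" "cw_value (refit v x) Far = cw_value v Far"
  "refit (refit v x) (fst v) = v"
  by (cases v; simp add: refit_def ccw_value_def xor.assoc)+

lemma xor_less: "x < 2 ^ m \<Longrightarrow> y < 2 ^ m \<Longrightarrow> Bit_Operations.xor x y < 2 ^ m" for x y :: nat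
  by (metis take_bit_nat_eq_self_iff take_bit_xor)

lemma refit_privates:
  "inputs T \<subseteq> {..<2 ^ width T} \<Longrightarrow> v \<in> privates T \<Longrightarrow> x \<in> inputs T \<Longrightarrow> refit v x \<in> privates T"
  by (auto simp: privates_def refit_def intro!: xor_less)

text \<open>The success probability of honest play while some input is still uniform.\<close>

definition chance :: "task \<Rightarrow> nat \<Rightarrow> real" where
  "chance T p = (if p \<in> fn_range T then 1 / card (fn_range T) else 0)"

lemma chance_nonneg: "0 \<le> chance T p"
  by (simp add: chance_def)

text \<open>The fibres over the range partition the inputs, and Full Knowledge makes them equally
  large.\<close>

lemma card_input_preimage:
  assumes T: "k_task k T" and xs: "set xs \<subseteq> inputs T" "j < length xs"
  shows "real (card {x \<in> inputs T. fn T (xs[j := x]) = p}) = chance T p * card (inputs T)"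
proof -
  have fin: "finite (inputs T)" "finite (fn_range T)" and fk: "full_knowledge T"
    using T by (auto simp: k_task_def)
  have in_range: "fn T (xs[j := x]) \<in> fn_range T" if "x \<in> inputs T" for x
    using xs that by (auto simp: fn_range_def intro!: imageI dest: set_update_subsetI)
  define c where "c y = card {x \<in> inputs T. fn T (xs[j := x]) = y}" for y
  show ?thesis
  proof (cases "p \<in> fn_range T")
    case True
    have "(\<Union>y\<in>fn_range T. {x \<in> inputs T. fn T (xs[j := x]) = y}) = inputs T" using in_range by blast
    then have "card (inputs T) = card (\<Union>y\<in>fn_range T. {x \<in> inputs T. fn T (xs[j := x]) = y})" by simp
    also have "\<dots> = (\<Sum>y\<in>fn_range T. c y)" unfolding c_def
      using fin by (intro card_UN_disjoint) auto
    also have "\<dots> = (\<Sum>y\<in>fn_range T. c p)"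
      unfolding c_def using fk[unfolded full_knowledge_def, rule_format, OF xs _ True] by (rule sum.cong[OF refl])
    finally have "card (inputs T) = card (fn_range T) * c p" by simp
    then show ?thesis using True fin by (auto simp: chance_def c_def)
  next
    case False
    have "{x \<in> inputs T. fn T (xs[j := x]) = p} = {}" using in_range False by blast
    show ?thesis unfolding \<open>_ = {}\<close> using False by (simp add: chance_def)
  qed
qed

text \<open>Sorting by ids only permutes the arguments, so index \<open>i\<close> occupies exactly
  one place of the argument list.\<close>

lemma card_eval_fn_preimage:
  assumes T: "k_task k T" and X: "\<And>i'. i' < length L \<Longrightarrow> X i' \<in> inputs T" and i: "i < length L"
  shows "real (card {x \<in> inputs T. eval_fn T L (X(i := x)) = p}) = chance T p * card (inputs T)"
proof -
  define s where "s = sort_key (\<lambda>i. L ! i) [0..<length L]"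
  have s: "set s = {0..<length L}" "distinct s" by (simp_all add: s_def)
  obtain j where j: "j < length s" "s ! j = i" using s i by (metis atLeastLessThan_iff in_set_conv_nth zero_le)
  have "map (X(i := x)) s = (map X s)[j := x]" for x
    using j s(2) by (auto intro!: nth_equalityI simp: nth_list_update nth_eq_iff_index_eq)
  then show ?thesis
    using card_input_preimage[OF T, of "map X s" j p] X s j(1)
    by (simp add: eval_fn_def flip: s_def) (auto simp: image_subset_iff)
qed

section \<open>Outcomes\<close>

definition success :: "nat \<Rightarrow> nat option list \<Rightarrow> bool" where
  "success p Os \<longleftrightarrow> Os ! 0 = Some p \<and> legal Os"

lemma utility_success: "utility p Os = (if success p Os then 1 else 0)"
  by (simp add: utility_def success_def)

lemma success_nth: "success p Os \<Longrightarrow> j < length Os \<Longrightarrow> Os ! j = Some p"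
  unfolding success_def legal_def by (metis gr_zeroI list.size(3) not_less_zero nth_mem option.inject)

definition swap_input :: "nat \<Rightarrow> (nat \<Rightarrow> private_data) \<Rightarrow> nat \<Rightarrow> nat \<Rightarrow> private_data" where
  "swap_input i w x = w(i := refit (w i) x)"

text \<open>All committed inputs but the last are independent of \<open>x\<close> by
  \<open>commit_hidden_input\<close>, so success forces \<open>x\<close> into a single fibre of the
  function.\<close>

lemma dishonest_success_le:
  assumes T: "k_task k T" and n: "2 \<le> n" "e < n" "length L = n + e"
    and w: "\<And>j. 1 \<le> j \<Longrightarrow> j < n \<Longrightarrow> w j \<in> privates T"
  shows "real (card {x \<in> inputs T. success p (outputs ring_protocol T n L S (swap_input (n - 1) w x))})
    \<le> chance T p * card (inputs T)" (is "real (card ?A) \<le> _")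
proof (cases "?A = {}")
  case True
  show ?thesis unfolding True by (simp add: chance_nonneg)
next
  case False
  \<comment> \<open>One success is needed to know that the committed values are possible inputs;
    Full Knowledge speaks only about those.\<close>
  then obtain x0 where x0: "x0 \<in> ?A" by blast
  define X where "X = committed n e S w"
  have main: "p = eval_fn T L (X(n + e - 1 := x))" "\<And>i. i < n + e \<Longrightarrow> (X(n + e - 1 := x)) i \<in> inputs T"
    if "x \<in> ?A" for x
  proof -
    define w' where "w' = swap_input (n - 1) w x"
    have "ring_output T L (j + e) (w' j) (seen n e S w' (2 * (n + e)) j) = Some p" if "1 \<le> j" "j < n" for j
      using success_nth[of p "outputs ring_protocol T n L S w'" j] \<open>x \<in> ?A\<close> that
      unfolding outputs_ring_protocol[OF n(3)] w'_def by simp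
    then have acc: "p = eval_fn T L (committed n e S w')" "\<And>i. i < n + e \<Longrightarrow> committed n e S w' i \<in> inputs T"
      using accepted_output[OF n, of T w' S p] by blast+
    have c: "commit n e S w' c = commit n e S w c" if "c \<le> e" for c
      by (rule commit_hidden_input[OF n(1,2)])
        (use that in \<open>simp_all add: w'_def swap_input_def refit_simps\<close>)
    have "committed n e S w' i = (X(n + e - 1 := x)) i" if "i < n + e" for i
    proof (cases "i = n + e - 1")
      case True
      moreover have "\<not> n + e - 1 \<le> e" "n + e - 1 - e = n - 1" using n by auto
      ultimately show ?thesis by (simp add: committed_def w'_def swap_input_def refit_simps)
    next
      case False
      then show ?thesis using c n by (auto simp: committed_def w'_def swap_input_def X_def)
    qed
    note eq = this
    then have "eval_fn T L (committed n e S w') = eval_fn T L (X(n + e - 1 := x))"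
      by (intro eval_fn_cong) (use n(3) in simp)
    with acc(1) show "p = eval_fn T L (X(n + e - 1 := x))" by simp
    show "(X(n + e - 1 := x)) i \<in> inputs T" if "i < n + e" for i
      using acc(2)[OF that] eq[OF that] by simp
  qed
  have X: "X i \<in> inputs T" if "i < length L" for i
  proof (cases "i = n + e - 1")
    case True
    moreover have "\<not> n + e - 1 \<le> e" "n + e - 1 - e = n - 1" using n by auto
    ultimately have "X i = fst (w (n - 1))" by (simp add: X_def committed_def)
    moreover have "w (n - 1) \<in> privates T" using w n by simp
    ultimately show ?thesis by (simp add: privates_def mem_Times_iff)
  next
    case False
    then show ?thesis using main(2)[OF x0, of i] that n by simp
  qed
  have "?A \<subseteq> {x \<in> inputs T. eval_fn T L (X(n + e - 1 := x)) = p}"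
    using main(1)[symmetric] by blast
  then have "card ?A \<le> card {x \<in> inputs T. eval_fn T L (X(n + e - 1 := x)) = p}"
    using T by (intro card_mono) (auto simp: k_task_def)
  also have "real \<dots> = chance T p * card (inputs T)"
    using n by (intro card_eval_fn_preimage[OF T X]) auto
  finally show ?thesis by simp
qed

lemma outputs_honest:
  assumes L: "2 \<le> length L" and v: "v \<in> privates T" and w: "\<And>j. 1 \<le> j \<Longrightarrow> j < length L \<Longrightarrow> w j \<in> privates T"
  shows "outputs ring_protocol T (length L) L (ring_protocol T L 0 v) w
    = replicate (length L) (Some (eval_fn T L (\<lambda>j. fst (if j = 0 then v else w j))))"
proof -
  define V where "V j = (if j = 0 then v else w j)" for j
  have V: "V i \<in> privates T" if "i < length L" for i using v w that by (simp add: V_def)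
  have "sybil_behaviour (length L) 0 (ring_protocol T L 0 v) w = (\<lambda>i. ring_behaviour (length L) i (V i))"
    by (auto simp: sybil_behaviour_def ring_protocol_def V_def)
  then have seen: "seen (length L) 0 (ring_protocol T L 0 v) w t j = map (msg_pair (length L) V j) [0..<t]"
    if "j < length L" for t j
    using honest_run[OF L that] by (simp add: seen_def)
  show ?thesis
  proof (rule nth_equalityI)
    fix j assume "j < length (outputs ring_protocol T (length L) L (ring_protocol T L 0 v) w)"
    then have j: "j < length L" by (simp add: outputs_ring_protocol[of L "length L" 0])
    have "outputs ring_protocol T (length L) L (ring_protocol T L 0 v) w ! j
       = ring_output T L j (V j) (seen (length L) 0 (ring_protocol T L 0 v) w (2 * length L) j)"
      using j by (simp add: outputs_ring_protocol[of L "length L" 0] V_def ring_protocol_def)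
    then show "outputs ring_protocol T (length L) L (ring_protocol T L 0 v) w ! j
      = replicate (length L) (Some (eval_fn T L (\<lambda>j. fst (if j = 0 then v else w j)))) ! j"
      using ring_output_honest[OF L j V, of "\<lambda>i. i"] unfolding seen[OF j] nth_replicate[OF j]
      by (simp add: V_def[abs_def])
  qed (simp add: outputs_ring_protocol[of L "length L" 0])
qed

lemma success_honest:
  assumes "2 \<le> length L" "v \<in> privates T" "\<And>j. 1 \<le> j \<Longrightarrow> j < length L \<Longrightarrow> w j \<in> privates T"
  shows "success p (outputs ring_protocol T (length L) L (ring_protocol T L 0 v) w)
    \<longleftrightarrow> eval_fn T L (\<lambda>j. fst (if j = 0 then v else w j)) = p"
proof -
  have "legal (replicate n (Some y))" for n :: nat and y by (auto simp: legal_def)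
  moreover have "0 < length L" using assms(1) by linarith
  moreover have "outputs ring_protocol T (length L) L (ring_protocol T L 0 v) w
    = replicate (length L) (Some (eval_fn T L (\<lambda>j. fst (if j = 0 then v else w j))))"
    by (rule outputs_honest) (use assms in auto)
  ultimately show ?thesis by (simp add: success_def del: length_greater_0_conv)
qed

lemma honest_success_eq:
  assumes T: "k_task k T" and L: "2 \<le> length L" and v: "v \<in> privates T"
    and w: "\<And>j. 1 \<le> j \<Longrightarrow> j < length L \<Longrightarrow> w j \<in> privates T"
  shows "real (card {x \<in> inputs T. success p (outputs ring_protocol T (length L) L (ring_protocol T L 0 v)
             (swap_input (length L - 1) w x))})
    = chance T p * card (inputs T)"
proof -
  define X where "X j = fst (if j = 0 then v else w j)" for j
  have X: "X j \<in> inputs T" if "j < length L" for j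
    using v w[of j] that by (auto simp: X_def privates_def mem_Times_iff)
  have "success p (outputs ring_protocol T (length L) L (ring_protocol T L 0 v) (swap_input (length L - 1) w x))
      \<longleftrightarrow> eval_fn T L (X(length L - 1 := x)) = p" if x: "x \<in> inputs T" for x
  proof -
    have p: "swap_input (length L - 1) w x j \<in> privates T" if "1 \<le> j" "j < length L" for j
      using T refit_privates[OF _ w[OF that] x] w[OF that] by (auto simp: swap_input_def k_task_def)
    have "fst (if j = 0 then v else swap_input (length L - 1) w x j) = (X(length L - 1 := x)) j" for j
      using L by (auto simp: X_def swap_input_def refit_simps)
    then have "(\<lambda>j. fst (if j = 0 then v else swap_input (length L - 1) w x j)) = X(length L - 1 := x)" ..
    moreover have "success p (outputs ring_protocol T (length L) L (ring_protocol T L 0 v) (swap_input (length L - 1) w x))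
      \<longleftrightarrow> eval_fn T L (\<lambda>j. fst (if j = 0 then v else swap_input (length L - 1) w x j)) = p"
      by (rule success_honest) (use L v p in auto)
    ultimately show ?thesis by simp
  qed
  then show ?thesis
    using card_eval_fn_preimage[OF T, where X = X and L = L and i = "length L - 1" and p = p] X L by (simp cong: conj_cong)
qed

section \<open>Expected utility of compound experiments\<close>

lemma integrable_utility: "integrable (measure_pmf M) (utility p)"
  by (rule measure_pmf.integrable_const_bound[where B = 1]) (auto simp: utility_success)

lemma expected_utility_bounds: "0 \<le> expected_utility p M" "expected_utility p M \<le> 1"
  by (auto simp: utility_success intro!: Bochner_Integration.integral_nonneg measure_pmf.integral_le_const integrable_utility[unfolded utility_success[abs_def]])

lemma integrable_expected_utility: "integrable (measure_pmf M) (\<lambda>x. expected_utility p (f x))"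
  by (rule measure_pmf.integrable_const_bound[where B = 1]) (auto simp: expected_utility_bounds)

text \<open>The law of total expectation, by way of the nonnegative integral, for which a bind
  raises no question of integrability.\<close>

lemma expected_utility_bind:
  "expected_utility p (bind_pmf M f) = measure_pmf.expectation M (\<lambda>x. expected_utility p (f x))"
proof -
  have *: "(\<integral>\<^sup>+x. ennreal (utility p x) \<partial>measure_pmf Q) = ennreal (expected_utility p Q)" for Q
    by (rule nn_integral_eq_integral[OF integrable_utility]) (simp add: utility_success)
  have "ennreal (expected_utility p (bind_pmf M f)) = (\<integral>\<^sup>+x. ennreal (expected_utility p (f x)) \<partial>measure_pmf M)"
    unfolding *[symmetric] by simp
  also have "\<dots> = ennreal (measure_pmf.expectation M (\<lambda>x. expected_utility p (f x)))"
    by (rule nn_integral_eq_integral) (auto simp: integrable_expected_utility expected_utility_bounds)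
  finally show ?thesis
    by (subst (asm) ennreal_inj) (auto intro!: Bochner_Integration.integral_nonneg expected_utility_bounds)
qed

lemma expected_utility_return: "expected_utility p (return_pmf Os) = (if success p Os then 1 else 0)"
  by (simp add: utility_success)

lemma expected_utility_bind_le:
  "(\<And>x. x \<in> set_pmf M \<Longrightarrow> expected_utility p (f x) \<le> c) \<Longrightarrow> expected_utility p (bind_pmf M f) \<le> c"
  unfolding expected_utility_bind
  by (intro measure_pmf.integral_le_const integrable_expected_utility) (simp add: AE_measure_pmf_iff)

lemma expected_utility_bind_ge:
  "(\<And>x. x \<in> set_pmf M \<Longrightarrow> c \<le> expected_utility p (f x)) \<Longrightarrow> c \<le> expected_utility p (bind_pmf M f)"
  unfolding expected_utility_bind
  by (intro measure_pmf.integral_ge_const integrable_expected_utility) (simp add: AE_measure_pmf_iff)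

lemma expected_utility_bind_eq:
  "(\<And>x. x \<in> set_pmf M \<Longrightarrow> expected_utility p (f x) = c) \<Longrightarrow> expected_utility p (bind_pmf M f) = c"
  by (intro antisym expected_utility_bind_le expected_utility_bind_ge) simp_all

lemma expected_utility_bind_mono:
  "(\<And>x. x \<in> set_pmf M \<Longrightarrow> expected_utility p (f x) \<le> expected_utility p (g x)) \<Longrightarrow>
   expected_utility p (bind_pmf M f) \<le> expected_utility p (bind_pmf M g)"
  unfolding expected_utility_bind
  by (intro integral_mono_AE integrable_expected_utility) (simp add: AE_measure_pmf_iff)

lemma expected_utility_bind_pmf_of_set:
  "finite W \<Longrightarrow> W \<noteq> {} \<Longrightarrow>
   expected_utility p (bind_pmf (pmf_of_set W) f) = (\<Sum>w\<in>W. expected_utility p (f w)) / card W"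
  unfolding expected_utility_bind by (rule integral_pmf_of_set)

lemma expected_utility_uniform:
  assumes "finite W" "W \<noteq> {}"
  shows "expected_utility p (bind_pmf (pmf_of_set W) (\<lambda>w. return_pmf (f w))) = card {w \<in> W. success p (f w)} / card W"
proof -
  have "(\<Sum>w\<in>W. if success p (f w) then 1 else 0 :: real) = card {w \<in> W. success p (f w)}"
    using assms(1) by (simp add: sum.inter_filter[symmetric])
  then show ?thesis
    unfolding expected_utility_bind_pmf_of_set[OF assms] expected_utility_return by simp
qed

definition privates_of_others :: "task \<Rightarrow> nat \<Rightarrow> (nat \<Rightarrow> private_data) set" where
  "privates_of_others T n = {1..<n} \<rightarrow>\<^sub>E privates T"

lemma privates_of_others:
  assumes "k_task k T"
  shows "finite (privates_of_others T n)" "privates_of_others T n \<noteq> {}"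
    "\<And>w j. w \<in> privates_of_others T n \<Longrightarrow> 1 \<le> j \<Longrightarrow> j < n \<Longrightarrow> w j \<in> privates T"
    "\<And>w x. w \<in> privates_of_others T n \<Longrightarrow> x \<in> inputs T \<Longrightarrow> 2 \<le> n \<Longrightarrow> swap_input (n - 1) w x \<in> privates_of_others T n"
proof -
  have T: "finite (inputs T)" "inputs T \<noteq> {}" "inputs T \<subseteq> {..<2 ^ width T}" using assms by (auto simp: k_task_def)
  then have "finite (privates T)" "privates T \<noteq> {}" by (auto simp: privates_def lessThan_empty_iff)
  then show "finite (privates_of_others T n)" "privates_of_others T n \<noteq> {}"
    by (auto simp: privates_of_others_def finite_PiE PiE_eq_empty_iff)
  show *: "w j \<in> privates T" if "w \<in> privates_of_others T n" "1 \<le> j" "j < n" for w j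
    using that by (auto simp: privates_of_others_def)
  show "swap_input (n - 1) w x \<in> privates_of_others T n"
    if "w \<in> privates_of_others T n" "x \<in> inputs T" "2 \<le> n" for w x
    using refit_privates[OF T(3) *[OF that(1), of "n - 1"] that(2)] that
    by (auto simp: privates_of_others_def swap_input_def PiE_def extensional_def Pi_def)
qed

section \<open>Averaging over data closed under resampling the last input\<close>

context
  fixes k :: nat and T :: task and n :: nat and W :: "(nat \<Rightarrow> private_data) set"
  assumes T: "k_task k T" and n: "2 \<le> n"
    and W: "W \<subseteq> privates_of_others T n" "W \<noteq> {}"
    and closed: "\<And>w x. w \<in> W \<Longrightarrow> x \<in> inputs T \<Longrightarrow> swap_input (n - 1) w x \<in> W"
begin

lemma finite_W: "finite W"
  using W(1) privates_of_others(1)[OF T] by (rule finite_subset)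

lemma finite_inputs: "finite (inputs T)" "inputs T \<noteq> {}"
  using T by (auto simp: k_task_def)

lemma swap_input_W:
  assumes "w \<in> W"
  shows "fst (w (n - 1)) \<in> inputs T" "fst (swap_input (n - 1) w x (n - 1)) = x"
    "swap_input (n - 1) (swap_input (n - 1) w x) (fst (w (n - 1))) = w"
proof -
  have "1 \<le> n - 1" "n - 1 < n" using n by linarith+
  then have "w (n - 1) \<in> privates T" using privates_of_others(3)[OF T, of w n "n - 1"] assms W(1) by blast
  then show "fst (w (n - 1)) \<in> inputs T" by (auto simp: privates_def)
qed (simp_all add: swap_input_def refit_simps)

text \<open>\<open>W\<close> stands for the data that the agent considers possible: all data before
  Wake-Up, and those consistent with its view at a later round before round
  \<open>N\<close>.\<close>

lemma dishonest_utility_le: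
  assumes "e < n" "length L = n + e"
  shows "expected_utility p (bind_pmf (pmf_of_set W) (\<lambda>w. return_pmf (outputs ring_protocol T n L S w))) \<le> chance T p"
proof -
  have le: "real (card {x \<in> inputs T. success p (outputs ring_protocol T n L S (swap_input (n - 1) w x))})
    \<le> chance T p * card (inputs T)" if "w \<in> W" for w
    by (rule dishonest_success_le[OF T n assms]) (use privates_of_others(3)[OF T] W(1) that in blast)
  have "real (card {w \<in> W. success p (outputs ring_protocol T n L S w)}) \<le> chance T p * card W"
    by (rule averaging_le[where re = "swap_input (n - 1)" and pr = "\<lambda>w. fst (w (n - 1))", OF finite_W finite_inputs])
      (use swap_input_W closed le in auto)
  then show ?thesis
    using finite_W W by (simp add: expected_utility_uniform divide_le_eq card_gt_0_iff)
qed

lemma honest_utility_eq: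
  assumes "length L = n" "v \<in> privates T"
  shows "expected_utility p (bind_pmf (pmf_of_set W)
      (\<lambda>w. return_pmf (outputs ring_protocol T n L (ring_protocol T L 0 v) w))) = chance T p"
proof -
  have eq: "real (card {x \<in> inputs T. success p (outputs ring_protocol T n L (ring_protocol T L 0 v) (swap_input (n - 1) w x))})
    = chance T p * card (inputs T)" if "w \<in> W" for w
    unfolding assms(1)[symmetric]
    by (rule honest_success_eq[OF T _ assms(2)])
      (use n privates_of_others(3)[OF T] W(1) that assms(1) in blast)+
  have "real (card {w \<in> W. success p (outputs ring_protocol T n L (ring_protocol T L 0 v) w)}) = chance T p * card W"
    by (rule averaging_eq[where re = "swap_input (n - 1)" and pr = "\<lambda>w. fst (w (n - 1))", OF finite_W finite_inputs])
      (use swap_input_W closed eq in auto)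
  then show ?thesis
    using finite_W W by (simp add: expected_utility_uniform divide_eq_eq)
qed

end

section \<open>Equilibrium on narrow intervals\<close>

text \<open>\<open>pmf_of_set\<close> is meaningful only on finite nonempty sets, so enough ids must
  remain beside the fake ones.\<close>

lemma random_ids:
  assumes "finite Ids" "set fids \<subseteq> Ids" "distinct fids" "length fids + m \<le> card Ids"
  shows "finite {ids. length ids = m \<and> distinct ids \<and> set ids \<subseteq> Ids - set fids}"
    "{ids. length ids = m \<and> distinct ids \<and> set ids \<subseteq> Ids - set fids} \<noteq> {}"
proof -
  show "finite {ids. length ids = m \<and> distinct ids \<and> set ids \<subseteq> Ids - set fids}"
    using finite_lists_length_eq[of "Ids - set fids" m] assms(1)
    by (rule_tac finite_subset[of _ "{xs. set xs \<subseteq> Ids - set fids \<and> length xs = m}"]) auto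
  have "m \<le> card (Ids - set fids)"
    using assms by (simp add: card_Diff_subset distinct_card)
  then obtain A where "A \<subseteq> Ids - set fids" "card A = m" "finite A"
    using obtain_subset_with_card_n by metis
  then obtain ids where "set ids = A" "distinct ids" "length ids = m"
    using finite_distinct_list distinct_card by metis
  then show "{ids. length ids = m \<and> distinct ids \<and> set ids \<subseteq> Ids - set fids} \<noteq> {}"
    using \<open>A \<subseteq> _\<close> by blast
qed

text \<open>The bound holds in every branch. A duplication that is not detected satisfies \<open>d +
  n - 1 \<le> \<beta> \<le> 2 * \<alpha> - 1 \<le> 2 * n - 1\<close>, whence
  \<open>e = d - 1 < n\<close>.\<close>

lemma initial_outcome_le:
  assumes T: "k_task k T" and ab: "2 \<le> \<alpha>" "\<alpha> \<le> \<beta>" "\<beta> \<le> 2 * \<alpha> - 1"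
    and Ids: "finite Ids" "\<beta> \<le> card Ids" and P: "valid_plan Ids P"
  shows "expected_utility p (initial_outcome ring_protocol \<alpha> \<beta> Ids T P) \<le> chance T p"
  unfolding initial_outcome_def
proof (rule expected_utility_bind_le, clarify, rule expected_utility_bind_le)
  fix fids S n
  assume "(fids, S) \<in> set_pmf P" and "n \<in> set_pmf (pmf_of_set {\<alpha>..\<beta>})"
  then have fids: "fids \<noteq> []" "distinct fids" "set fids \<subseteq> Ids" and n: "\<alpha> \<le> n" "n \<le> \<beta>"
    using P ab by (auto simp: valid_plan_def)
  have n2: "2 \<le> n" using n ab by simp
  show "expected_utility p
      (if \<beta> < length fids + n - 1 then return_pmf (replicate n None)
       else do { ids \<leftarrow> pmf_of_set {ids. length ids = n - 1 \<and> distinct ids \<and> set ids \<subseteq> Ids - set fids};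
                 w \<leftarrow> pmf_of_set ({1..<n} \<rightarrow>\<^sub>E privates T);
                 return_pmf (outputs ring_protocol T n (fids @ ids) (S (fids @ ids)) w)}) \<le> chance T p"
  proof (cases "\<beta> < length fids + n - 1")
    case True
    have "replicate n (None :: nat option) ! 0 = None" using n2 by (intro nth_replicate) linarith
    then have "\<not> success p (replicate n None)" by (simp add: success_def)
    then show ?thesis
      unfolding if_P[OF True] expected_utility_return by (simp add: chance_nonneg)
  next
    case False
    then have le: "length fids + (n - 1) \<le> card Ids" using Ids(2) n2 by linarith
    show ?thesis
      unfolding if_not_P[OF False]
    proof (rule expected_utility_bind_le)
      fix ids assume "ids \<in> set_pmf (pmf_of_set {ids. length ids = n - 1 \<and> distinct ids \<and> set ids \<subseteq> Ids - set fids})"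
      then have "length ids = n - 1"
        using random_ids[OF Ids(1) fids(3,2) le] by (simp add: set_pmf_of_set)
      then show "expected_utility p (pmf_of_set ({1..<n} \<rightarrow>\<^sub>E privates T) \<bind>
            (\<lambda>w. return_pmf (outputs ring_protocol T n (fids @ ids) (S (fids @ ids)) w))) \<le> chance T p"
        unfolding privates_of_others_def[symmetric]
      proof (intro dishonest_utility_le[OF T n2, where e = "length fids - 1"] order_refl)
        have "1 \<le> length fids" using fids(1) by (cases fids) auto
        then show "length fids - 1 < n" "length (fids @ ids) = n + (length fids - 1)"
          using False n ab n2 \<open>length ids = n - 1\<close> unfolding length_append by linarith+
      qed (use privates_of_others[OF T] n2 in blast)+
    qed
  qed
qed

lemma initial_outcome_honest:
  assumes T: "k_task k T" and ab: "2 \<le> \<alpha>" "\<alpha> \<le> \<beta>"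
    and Ids: "finite Ids" "\<beta> \<le> card Ids" and me: "me \<in> Ids" "x \<in> inputs T"
  shows "expected_utility p (initial_outcome ring_protocol \<alpha> \<beta> Ids T (honest_plan ring_protocol T me x)) = chance T p"
  unfolding initial_outcome_def
proof (rule expected_utility_bind_eq, clarify, rule expected_utility_bind_eq)
  fix fids S n
  assume "(fids, S) \<in> set_pmf (honest_plan ring_protocol T me x)" and "n \<in> set_pmf (pmf_of_set {\<alpha>..\<beta>})"
  then obtain v where v: "fids = [me]" "S = (\<lambda>L. ring_protocol T L 0 v)" "v \<in> privates T" and n: "\<alpha> \<le> n" "n \<le> \<beta>"
    using ab me by (auto simp: honest_plan_def set_pmf_of_set lessThan_empty_iff privates_def)
  have n2: "2 \<le> n" using n ab by simp
  have *: "\<not> \<beta> < length fids + n - 1" using n by (simp add: v)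
  show "expected_utility p
      (if \<beta> < length fids + n - 1 then return_pmf (replicate n None)
       else do { ids \<leftarrow> pmf_of_set {ids. length ids = n - 1 \<and> distinct ids \<and> set ids \<subseteq> Ids - set fids};
                 w \<leftarrow> pmf_of_set ({1..<n} \<rightarrow>\<^sub>E privates T);
                 return_pmf (outputs ring_protocol T n (fids @ ids) (S (fids @ ids)) w)}) = chance T p"
    unfolding if_not_P[OF *] v(2)
  proof (rule expected_utility_bind_eq)
    fix ids assume "ids \<in> set_pmf (pmf_of_set {ids. length ids = n - 1 \<and> distinct ids \<and> set ids \<subseteq> Ids - set fids})"
    then have "length ids = n - 1"
      using random_ids[OF Ids(1), of fids "n - 1"] n n2 me Ids(2) by (simp add: set_pmf_of_set v)
    then show "expected_utility p (pmf_of_set ({1..<n} \<rightarrow>\<^sub>E privates T) \<bind>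
          (\<lambda>w. return_pmf (outputs ring_protocol T n (fids @ ids) (ring_protocol T (fids @ ids) 0 v) w))) = chance T p"
      unfolding privates_of_others_def[symmetric]
    proof (intro honest_utility_eq[OF T n2] order_refl v(3))
      show "length (fids @ ids) = n" using n2 \<open>length ids = n - 1\<close> by (simp add: v)
    qed (use privates_of_others[OF T] n2 in blast)+
  qed
qed

lemma initial_equilibrium_ring_protocol:
  assumes "k_task k T" "2 \<le> \<alpha>" "\<alpha> \<le> \<beta>" "\<beta> \<le> 2 * \<alpha> - 1" "finite Ids" "\<beta> \<le> card Ids"
  shows "initial_equilibrium ring_protocol \<alpha> \<beta> Ids T"
  unfolding initial_equilibrium_def
  using initial_outcome_le[OF assms] initial_outcome_honest[OF assms(1-3,5,6)] by auto

lemma solves_ring_protocol: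
  assumes "k_task k T" "2 \<le> \<alpha>"
  shows "solves ring_protocol \<alpha> \<beta> Ids T"
  unfolding solves_def
proof (intro allI impI)
  fix L :: "nat list" and w
  assume L: "length L \<in> {\<alpha>..\<beta>}" and w: "\<forall>j<length L. w j \<in> privates T"
  have L2: "2 \<le> length L" using L assms(2) by simp
  then have "0 < length L" by linarith
  then have "outputs ring_protocol T (length L) L (ring_protocol T L 0 (w 0)) w
    = replicate (length L) (Some (eval_fn T L (\<lambda>j. fst (if j = 0 then w 0 else w j))))"
    by (intro outputs_honest L2) (use w in blast)+
  also have "(\<lambda>j. fst (if j = 0 then w 0 else w j)) = (\<lambda>j. fst (w j))" by auto
  finally show "outputs ring_protocol T (length L) L (ring_protocol T L 0 (w 0)) w
    = replicate (length L) (Some (eval_fn T L (\<lambda>j. fst (w j))))" .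
qed

section \<open>Deviations after Wake-Up\<close>

lemma honest_view_ring_protocol:
  "honest_view ring_protocol T L v r w = seen (length L) 0 (ring_protocol T L 0 v) w r 0"
proof -
  have "(\<lambda>j. fst (ring_protocol T L j (if j = 0 then v else w j))) = sybil_behaviour (length L) 0 (ring_protocol T L 0 v) w"
    by (auto simp: sybil_behaviour_def ring_protocol_def)
  then show ?thesis by (simp add: honest_view_def seen_def)
qed

text \<open>Conditioning a uniform distribution leaves it uniform on the event.\<close>

lemma posterior_ring_protocol:
  assumes T: "k_task k T" and h: "h \<in> honest_view ring_protocol T L v r ` privates_of_others T (length L)"
  shows "posterior ring_protocol T L v r h
    = pmf_of_set {w \<in> privates_of_others T (length L). honest_view ring_protocol T L v r w = h}"
proof -
  let ?A = "privates_of_others T (length L)" and ?B = "{w. honest_view ring_protocol T L v r w = h}"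
  have A: "finite ?A" "?A \<noteq> {}" using privates_of_others[OF T] by auto
  have ne: "?A \<inter> ?B \<noteq> {}" using h by auto
  have "cond_pmf (pmf_of_set ?A) ?B = pmf_of_set (?A \<inter> ?B)"
  proof (rule pmf_eqI)
    fix w
    have "measure (measure_pmf (pmf_of_set ?A)) ?B = card (?A \<inter> ?B) / card ?A"
      using A(2,1) by (rule measure_pmf_of_set)
    moreover have "card ?A > 0" "card (?A \<inter> ?B) > 0" using A ne by (auto simp: card_gt_0_iff)
    ultimately show "pmf (cond_pmf (pmf_of_set ?A) ?B) w = pmf (pmf_of_set (?A \<inter> ?B)) w"
      using A ne by (subst pmf_cond) (auto simp: indicator_def)
  qed
  moreover have "?A \<inter> ?B = {w \<in> ?A. honest_view ring_protocol T L v r w = h}" by blast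
  ultimately show ?thesis by (simp add: posterior_def privates_of_others_def)
qed

lemma switch_same: "switch r S S = S"
  by (simp add: switch_def)

lemma length_seen: "length (seen n e S w t j) = t"
  by (simp add: seen_conv)

lemma seen_switch: "t \<le> r \<Longrightarrow> seen n e (switch r S S') w t j = seen n e S w t j"
proof (induction t arbitrary: j)
  case (Suc t)
  then have "sent n e (switch r S S') w t i = sent n e S w t i" for i
    by (simp add: sent_def sybil_behaviour_def switch_def length_seen)
  then show ?case
    using Suc unfolding seen_conv by simp
qed (simp add: seen_def)

lemma sent_switch: "t < r \<Longrightarrow> sent n e (switch r S S') w t j = sent n e S w t j"
  unfolding sent_def by (subst seen_switch) (simp_all add: sybil_behaviour_def switch_def length_seen)

text \<open>From round \<open>N\<close> on it is too late: the shares of round \<open>N - 1\<close>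
  were sent honestly, so the value to which the deviator is committed is its true input. If the
  others accept, they output what honest play gives.\<close>

lemma success_switch:
  assumes T: "k_task k T" and L: "2 \<le> length L" and v: "v \<in> privates T"
    and w: "\<And>j. 1 \<le> j \<Longrightarrow> j < length L \<Longrightarrow> w j \<in> privates T"
    and r: "length L \<le> r"
    and s: "success p (outputs ring_protocol T (length L) L (switch r (ring_protocol T L 0 v) S) w)"
  shows "success p (outputs ring_protocol T (length L) L (ring_protocol T L 0 v) w)"
proof -
  let ?N = "length L" and ?H = "ring_protocol T L 0 v"
  let ?S = "switch r ?H S"
  define V where "V j = (if j = 0 then v else w j)" for j
  have beh: "sybil_behaviour ?N 0 ?H w = (\<lambda>i. ring_behaviour ?N i (V i))"
    by (auto simp: sybil_behaviour_def ring_protocol_def V_def)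
  have sent: "sent ?N 0 ?S w (?N - 1) j = (cw_msg ?N V j (?N - 1), ccw_msg ?N V j (?N - 1))" if "j < ?N" for j
  proof -
    have "sent ?N 0 ?S w (?N - 1) j = sent ?N 0 ?H w (?N - 1) j"
      by (rule sent_switch) (use r L in linarith)
    also have "\<dots> = ring_behaviour ?N j (V j) (map (msg_pair ?N V j) [0..<?N - 1])"
      unfolding sent_def seen_def beh honest_run[OF L that] ..
    finally show ?thesis unfolding ring_behaviour_honest[OF L that] .
  qed
  have acc: "ring_output T L (j + 0) (w j) (seen ?N 0 ?S w (2 * (?N + 0)) j) = Some p" if "1 \<le> j" "j < ?N" for j
    using success_nth[OF s, of j] that by (simp add: outputs_ring_protocol[of L ?N 0])
  have n: "2 \<le> ?N" "0 < ?N" "length L = ?N + 0" using L by linarith+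
  have p: "p = eval_fn T L (committed ?N 0 ?S w)" by (rule accepted_output(1)[OF n acc])
  have "Share 0 Near y \<in> fst (sent ?N 0 ?S w (?N + 0 - 1) (1 - 1)) \<longleftrightarrow> y = cw_value v Near" for y
    using L n(2) sent[OF n(2)] by (simp add: Share_in_last_cw_msg[OF L, simplified] V_def)
  moreover have "Share 0 Near y \<in> snd (sent ?N 0 ?S w (?N + 0 - 1) ((1 + 1) mod ?N)) \<longleftrightarrow> y = ccw_value v Near" for y
  proof -
    have "1 < ?N" using L by simp
    \<comment> \<open>On a ring of two agents this neighbour of the target is the deviator
      itself.\<close>
    then obtain c where "(1 + 1) mod ?N = c" "c < ?N" "1 + 1 = c \<or> 1 + 1 = c + ?N"
      using neighbour_bounds[OF L, of 1] by metis
    then show ?thesis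
      using L sent[of c] by (auto simp: Share_in_last_ccw_msg[OF L, simplified] V_def mod_Suc)
  qed
  ultimately have "commit ?N 0 ?S w 0 = fst v"
    unfolding commit_def by (simp only: commit_side_def commit_pos_def if_True refl) (simp add: xor_shares)
  then have "committed ?N 0 ?S w = (\<lambda>j. fst (V j))" by (auto simp: committed_def V_def)
  then have "eval_fn T L (\<lambda>j. fst (if j = 0 then v else w j)) = p" using p by (simp add: V_def)
  then show ?thesis using success_honest[OF L v, of w p] w by blast
qed

text \<open>Before round \<open>N\<close> the view does not change when the last input is resampled,
  so both utilities are compared with \<open>chance\<close>. From round \<open>N\<close> on, a
  deviation succeeds only where honest play does.\<close>

lemma later_equilibrium_ring_protocol:
  assumes T: "k_task k T" and "2 \<le> \<alpha>"
  shows "later_equilibrium ring_protocol \<alpha> \<beta> Ids T"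
  unfolding later_equilibrium_def privates_of_others_def[symmetric]
proof (intro allI impI ballI)
  fix L v p D r h
  let ?H = "ring_protocol T L 0 v"
  define W where "W = {w \<in> privates_of_others T (length L). honest_view ring_protocol T L v r w = h}"
  assume L: "length L \<in> {\<alpha>..\<beta>}" and v: "v \<in> privates T"
    and h: "h \<in> honest_view ring_protocol T L v r ` privates_of_others T (length L)"
  have L2: "2 \<le> length L" using L assms(2) by simp
  have W: "W \<subseteq> privates_of_others T (length L)" "W \<noteq> {}" "finite W"
    using h privates_of_others(1)[OF T] by (auto simp: W_def)
  note post = posterior_ring_protocol[OF T h, folded W_def]
  define out where "out S = bind_pmf (pmf_of_set W) (\<lambda>w. return_pmf (outputs ring_protocol T (length L) L (switch r ?H S) w))" for S
  \<comment> \<open>Drawing the strategy first reduces randomized deviations to deterministic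
    ones.\<close>
  have out: "outcome_from ring_protocol T L v r h Q = bind_pmf Q out" for Q
    unfolding outcome_from_def post out_def by (rule bind_commute_pmf)
  have "expected_utility p (out S) \<le> expected_utility p (out ?H)" for S
  proof (cases "r < length L")
    case True
    have closed: "swap_input (length L - 1) w x \<in> W" if "w \<in> W" "x \<in> inputs T" for w x
    proof -
      have "seen (length L) 0 ?H (swap_input (length L - 1) w x) r 0 = seen (length L) 0 ?H w r 0"
        by (rule seen_hidden_input) (use L2 True in \<open>auto simp: swap_input_def refit_simps\<close>)
      then show ?thesis
        using that privates_of_others(4)[OF T _ _ L2] by (simp add: W_def honest_view_ring_protocol)
    qed
    have "expected_utility p (out S) \<le> chance T p"
      unfolding out_def using L2
      by (intro dishonest_utility_le[OF T L2 W(1,2) closed, where e = 0]) auto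
    also have "\<dots> = expected_utility p (out ?H)"
      unfolding out_def switch_same by (intro honest_utility_eq[OF T L2 W(1,2) closed, symmetric] v) auto
    finally show ?thesis .
  next
    case False
    have "success p (outputs ring_protocol T (length L) L (switch r ?H S) w)
      \<Longrightarrow> success p (outputs ring_protocol T (length L) L ?H w)" if "w \<in> W" for w
      by (rule success_switch[OF T L2 v]) (use that W(1) False privates_of_others(3)[OF T] in auto)
    then show ?thesis
      unfolding out_def switch_same using W
      by (intro expected_utility_bind_mono) (simp add: utility_success set_pmf_of_set)
  qed
  then show "expected_utility p (outcome_from ring_protocol T L v r h D)
      \<le> expected_utility p (outcome_from ring_protocol T L v r h (return_pmf ?H))"
    unfolding out bind_return_pmf by (intro expected_utility_bind_le)
qed

section \<open>The attack on wide intervals\<close>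

text \<open>Addition modulo \<open>2 ^ m\<close>: here \<open>k = 2 ^ m\<close> can be made as large
  as desired, and whoever fixes the last input chooses the output.\<close>

definition sum_task :: "nat \<Rightarrow> task" where
  "sum_task m = \<lparr>inputs = {..<2 ^ m}, width = m, fn = (\<lambda>xs. sum_list xs mod 2 ^ m)\<rparr>"

lemma sum_task_simps [simp]:
  "inputs (sum_task m) = {..<2 ^ m}" "width (sum_task m) = m" "fn (sum_task m) xs = sum_list xs mod 2 ^ m"
  by (simp_all add: sum_task_def)

lemma fn_range_sum_task: "fn_range (sum_task m) = {..<2 ^ m}"
proof
  show "{..<2 ^ m} \<subseteq> fn_range (sum_task m)"
  proof
    fix y :: nat assume "y \<in> {..<2 ^ m}"
    then have "y = fn (sum_task m) [y]" "set [y] \<subseteq> {..<2 ^ m}" by simp_all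
    then show "y \<in> fn_range (sum_task m)" unfolding fn_range_def by (intro image_eqI[of _ _ "[y]"]) simp_all
  qed
qed (auto simp: fn_range_def)

lemma card_shifted_residue:
  fixes K c y :: nat
  assumes "0 < K" "y < K"
  shows "card {x \<in> {..<K}. (x + c) mod K = y} = 1"
proof -
  define r where "r = c mod K"
  have r: "r < K" using assms(1) by (simp add: r_def)
  define x0 where "x0 = (if r \<le> y then y - r else y + K - r)"
  have "(x + c) mod K = y \<longleftrightarrow> x = x0" if "x < K" for x
  proof -
    have "(x + c) mod K = (x + r) mod K" by (simp add: r_def mod_add_right_eq)
    also have "\<dots> = y \<longleftrightarrow> x + r = y \<or> x + r = y + K"
      using that r assms(2) by (intro mod_add_eq_iff) auto
    also have "\<dots> \<longleftrightarrow> x = x0" using that r assms(2) unfolding x0_def by auto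
    finally show ?thesis .
  qed
  moreover have "x0 < K" using r assms(2) by (auto simp: x0_def)
  ultimately have "{x \<in> {..<K}. (x + c) mod K = y} = {x0}" by auto
  then show ?thesis by simp
qed

text \<open>In each single argument the sum permutes the residues, so all fibres have size
  \<open>1\<close>.\<close>

lemma k_task_sum_task: "k_task (2 ^ m) (sum_task m)"
proof -
  have "card {x \<in> {..<2 ^ m}. sum_list (xs[j := x]) mod 2 ^ m = y} = 1" if "j < length xs" "y < 2 ^ m" for xs :: "nat list" and j y
  proof -
    have "sum_list (xs[j := x]) = x + (sum_list xs - xs ! j)" for x
      using sum_list_update[of j xs x] that member_le_sum_list[of "xs ! j" xs] by simp
    then show ?thesis using card_shifted_residue[of "2 ^ m" y "sum_list xs - xs ! j"] that by simp
  qed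
  then have "full_knowledge (sum_task m)" by (simp add: full_knowledge_def fn_range_sum_task)
  then show ?thesis by (simp add: k_task_def fn_range_sum_task lessThan_empty_iff)
qed

lemma eval_fn_sum_task: "eval_fn (sum_task m) L X = (\<Sum>i<length L. X i) mod 2 ^ m"
proof -
  have "sum_list (map X (sort_key f xs)) = sum_list (map X xs)" for f :: "nat \<Rightarrow> nat" and xs
    by (metis mset_map mset_sort sum_mset_sum_list)
  then show ?thesis
    by (simp add: eval_fn_def interv_sum_list_conv_sum_set_nat atLeast0LessThan)
qed

text \<open>With \<open>N = 2 * n\<close> only the counter-clockwise shares of agent \<open>0\<close> leave the simulated block. If both
  random numbers are equal to the input, these shares are \<open>0\<close>, whatever the input is.\<close>

definition forged_input :: "nat \<Rightarrow> nat \<Rightarrow> (nat \<Rightarrow> private_data) \<Rightarrow> nat" where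
  "forged_input n m w = (2 ^ m - (\<Sum>j=1..<n. fst (w j)) mod 2 ^ m) mod 2 ^ m"

text \<open>The data that the honest agents are led to believe in. The simulated indices run from
  \<open>0\<close> to \<open>n\<close>, that is \<open>e = n\<close>, and all inputs add up to
  \<open>0\<close> modulo \<open>2 ^ m\<close>.\<close>

definition forged :: "nat \<Rightarrow> nat \<Rightarrow> (nat \<Rightarrow> private_data) \<Rightarrow> nat \<Rightarrow> private_data" where
  "forged n m w i =
     (if i = 0 then (forged_input n m w, forged_input n m w, forged_input n m w)
      else if i \<le> n then (0, 0, 0) else w (i - n))"

definition forged_view :: "nat \<Rightarrow> nat \<Rightarrow> (nat \<Rightarrow> private_data) \<Rightarrow> nat \<Rightarrow> history" where
  "forged_view n m w t =
     map (\<lambda>u. (cw_msg (2 * n) (forged n m w) (2 * n - 1) u, ccw_msg (2 * n) (forged n m w) (n + 1) u)) [0..<t]"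

definition forged_send :: "nat \<Rightarrow> nat \<Rightarrow> (nat \<Rightarrow> private_data) \<Rightarrow> nat \<Rightarrow> msg \<times> msg" where
  "forged_send n m w t =
     (cw_msg (2 * n) (forged n m w) n t, ccw_msg (2 * n) (forged n m w) 0 t)"

text \<open>The cheater acts as the block would in a forged execution that explains its view. Any
  such \<open>w\<close> will do, because by \<open>forged_send_cong\<close> the view determines the
  next message.\<close>

definition attack :: "nat \<Rightarrow> nat \<Rightarrow> strategy" where
  "attack n m = ((\<lambda>h. forged_send n m (SOME w. forged_view n m w (length h) = h) (length h)), (\<lambda>h. Some 0))"

lemma forged_view_nth:
  assumes "forged_view n m w t = forged_view n m w' t" "u < t"
  shows "cw_msg (2 * n) (forged n m w) (2 * n - 1) u = cw_msg (2 * n) (forged n m w') (2 * n - 1) u"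
    "ccw_msg (2 * n) (forged n m w) (n + 1) u = ccw_msg (2 * n) (forged n m w') (n + 1) u"
  using arg_cong[OF assms(1), of "\<lambda>h. h ! u"] assms(2) by (simp_all add: forged_view_def)

section \<open>What the view of the cheater determines\<close>

lemma Share_in_early_cw_msg:
  "t + 1 < N \<Longrightarrow> Share a s y \<in> cw_msg N V j t \<longleftrightarrow>
     a < N \<and> y = cw_value (V a) s \<and> (a + t) mod N = j \<and> t + 1 < cw_dist N s"
  by (auto simp: cw_msg_def)

lemma Share_in_early_ccw_msg:
  "t + 1 < N \<Longrightarrow> Share a s y \<in> ccw_msg N V j t \<longleftrightarrow>
     a < N \<and> y = ccw_value (V a) s \<and> (a + (N - t)) mod N = j \<and> t + 1 < ccw_dist N s"
  by (auto simp: ccw_msg_def)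

text \<open>The share of \<open>a\<close> crosses from \<open>n + 1\<close> into the block at round
  \<open>a - n - 1\<close>, since its target lies beyond agent \<open>n\<close>.\<close>

lemma forged_view_ccw_share:
  assumes view: "forged_view n m w t = forged_view n m w' t"
    and a: "2 \<le> n" "n < a" "a < 2 * n" "a < t + n + 1" "a - n < ccw_dist (2 * n) s"
  shows "ccw_value (forged n m w a) s = ccw_value (forged n m w' a) s"
proof -
  define u where "u = a - n - 1"
  have u: "u < t" "u + 1 < 2 * n" "a + (2 * n - u) = n + 1 + 2 * n" "u + 1 < ccw_dist (2 * n) s" using a by (auto simp: u_def)
  have "(a + (2 * n - u)) mod (2 * n) = n + 1" unfolding u(3) mod_add_self2 using a by simp
  then have "Share a s y \<in> ccw_msg (2 * n) (forged n m x) (n + 1) u \<longleftrightarrow> y = ccw_value (forged n m x a) s" for x y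
    using u a by (simp add: Share_in_early_ccw_msg)
  then show ?thesis using forged_view_nth(2)[OF view u(1)] by metis
qed

lemma forged_view_cw_share:
  assumes view: "forged_view n m w t = forged_view n m w' t"
    and a: "2 \<le> n" "n < a" "a < 2 * n" "2 * n \<le> a + t" "2 * n - a < cw_dist (2 * n) s"
  shows "cw_value (forged n m w a) s = cw_value (forged n m w' a) s"
proof -
  define u where "u = 2 * n - 1 - a"
  have u: "u < t" "u + 1 < 2 * n" "a + u = 2 * n - 1" "u + 1 < cw_dist (2 * n) s" using a by (auto simp: u_def)
  have "(a + u) mod (2 * n) = 2 * n - 1" unfolding u(3) using a by simp
  then have "Share a s y \<in> cw_msg (2 * n) (forged n m x) (2 * n - 1) u \<longleftrightarrow> y = cw_value (forged n m x a) s" for x y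
    using u a by (simp add: Share_in_early_cw_msg)
  then show ?thesis using forged_view_nth(1)[OF view u(1)] by metis
qed

text \<open>The cheater never has to send what it does not know yet: of agent \<open>0\<close> only
  the zero shares leave the block before round \<open>N\<close>, and its input is announced when the
  inputs of all honest agents are known.\<close>

lemma forged_send_cong:
  assumes n: "2 \<le> n" and view: "forged_view n m w t = forged_view n m w' t"
  shows "forged_send n m w t = forged_send n m w' t"
proof -
  let ?N = "2 * n" and ?V = "forged n m w" and ?V' = "forged n m w'"
  have low: "cw_value (?V a) s = cw_value (?V' a) s" if "1 \<le> a" "a \<le> n" for a s
    using that by (simp add: forged_def)
  have low': "ccw_value (?V a) s = ccw_value (?V' a) s" if "a \<le> n" for a s
    using that by (cases s) (simp_all add: forged_def ccw_value_def)
  have dist: "cw_dist ?N s \<le> n" "ccw_dist ?N Far = n" "cw_dist ?N Far = n" for s using n by (cases s; simp)+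
  have near: "ccw_value (?V a) s = ccw_value (?V' a) s" if "a < ?N" "a < t + n" "a - n < ccw_dist ?N s" for a s
    using low'[of a s] forged_view_ccw_share[OF view n, of a s] that by (cases "a \<le> n") auto
  consider "t + 1 < ?N" | "t + 1 = ?N" | "t = ?N" | "?N < t" by linarith
  then show ?thesis
  proof cases
    case 1
    have "{Share a s (cw_value (?V a) s) | a s. a < ?N \<and> (a + t) mod ?N = n \<and> t + 1 < cw_dist ?N s}
        = {Share a s (cw_value (?V' a) s) | a s. a < ?N \<and> (a + t) mod ?N = n \<and> t + 1 < cw_dist ?N s}"
    proof -
      have "cw_value (?V a) s = cw_value (?V' a) s" if "a < ?N" "(a + t) mod ?N = n" "t + 1 < cw_dist ?N s" for a s
      proof (rule low)
        have "a + t = n" using mod_add_eq_iff[OF that(1), of t n] that dist(1)[of s] n by auto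
        then show "1 \<le> a" "a \<le> n" using that dist(1)[of s] by auto
      qed
      then show ?thesis by force
    qed
    moreover have "{Share a s (ccw_value (?V a) s) | a s. a < ?N \<and> (a + (?N - t)) mod ?N = 0 \<and> t + 1 < ccw_dist ?N s}
        = {Share a s (ccw_value (?V' a) s) | a s. a < ?N \<and> (a + (?N - t)) mod ?N = 0 \<and> t + 1 < ccw_dist ?N s}"
    proof -
      have "ccw_value (?V a) s = ccw_value (?V' a) s" if "a < ?N" "(a + (?N - t)) mod ?N = 0" "t + 1 < ccw_dist ?N s" for a s
      proof (rule near)
        have "a = t" using mod_add_eq_iff[OF that(1), of "?N - t" 0] that n 1 by auto
        then show "a < t + n" "a - n < ccw_dist ?N s" using that n by auto
      qed (rule that(1))
      then show ?thesis by force
    qed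
    ultimately show ?thesis using 1 by (simp add: forged_send_def cw_msg_def ccw_msg_def)
  next
    case 2
    have "{Share a s (cw_value (?V a) s) | a s. a < ?N \<and> target ?N s a = (n + 1) mod ?N}
        = {Share a s (cw_value (?V' a) s) | a s. a < ?N \<and> target ?N s a = (n + 1) mod ?N}"
    proof -
      \<comment> \<open>Clockwise shares for \<open>n + 1\<close> come from agents \<open>1\<close>
        to \<open>n\<close>: the far target of agent \<open>0\<close> is \<open>n\<close>, still
        inside the block.\<close>
      have "cw_value (?V a) s = cw_value (?V' a) s" if "a < ?N" "target ?N s a = (n + 1) mod ?N" for a s
      proof (rule low)
        have "(a + cw_dist ?N s) mod ?N = n + 1" using that n by (simp only: target_cw_dist) simp
        then have "a + cw_dist ?N s = n + 1"
          using mod_add_eq_iff[OF that(1), of "cw_dist ?N s" "n + 1"] that dist(1)[of s] n by auto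
        then show "1 \<le> a" "a \<le> n" using cw_dist_bounds(1)[of ?N s] dist(1)[of s] n by linarith+
      qed
      then show ?thesis by force
    qed
    moreover have "{Share a s (ccw_value (?V a) s) | a s. a < ?N \<and> target ?N s a = (0 + ?N - 1) mod ?N}
        = {Share a s (ccw_value (?V' a) s) | a s. a < ?N \<and> target ?N s a = (0 + ?N - 1) mod ?N}"
    proof -
      have "ccw_value (?V a) s = ccw_value (?V' a) s" if "a < ?N" "target ?N s a = (0 + ?N - 1) mod ?N" for a s
      proof (rule near)
        have "(a + cw_dist ?N s) mod ?N = ?N - 1" using that n by (simp only: target_cw_dist) simp
        then have "a + cw_dist ?N s = ?N - 1"
          using mod_add_eq_iff[OF that(1), of "cw_dist ?N s" "?N - 1"] that dist(1)[of s] n by auto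
        then show "a < t + n" "a - n < ccw_dist ?N s"
          using cw_dist_bounds(1)[of ?N s] ccw_dist_bounds(1)[of ?N s] dist 2 n by (cases s; simp)+
      qed (rule that(1))
      then show ?thesis by force
    qed
    ultimately show ?thesis using 2 by (simp add: forged_send_def cw_msg_def ccw_msg_def)
  next
    case 3
    then show ?thesis by (simp add: forged_send_def cw_msg_def ccw_msg_def)
  next
    case 4
    \<comment> \<open>The far target of every honest agent is simulated. By now both far shares have
      entered the block and reveal its input, which in turn determines
      \<open>forged_input\<close>.\<close>
    have "fst (w j) = fst (w' j)" if "1 \<le> j" "j < n" for j
    proof -
      have "cw_value (?V (n + j)) Far = cw_value (?V' (n + j)) Far"
        by (rule forged_view_cw_share[OF view n]) (use that 4 dist in auto)
      moreover have "ccw_value (?V (n + j)) Far = ccw_value (?V' (n + j)) Far"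
        by (rule forged_view_ccw_share[OF view n]) (use that 4 dist in auto)
      ultimately have "fst (?V (n + j)) = fst (?V' (n + j))" by (metis xor_shares)
      then show ?thesis using that by (simp add: forged_def)
    qed
    moreover from this have "(\<Sum>j=1..<n. fst (w j)) = (\<Sum>j=1..<n. fst (w' j))" by (intro sum.cong) auto
    ultimately have "fst (?V a) = fst (?V' a)" if "a < ?N" for a
      using that by (auto simp: forged_def forged_input_def)
    then show ?thesis using 4 by (auto simp: forged_send_def cw_msg_def ccw_msg_def)
  qed
qed

text \<open>One induction for the cheater and the honest agents, as each history is made of messages
  of the others.\<close>

lemma seen_attack:
  assumes n: "2 \<le> n"
  shows "seen n n (attack n m) w t 0 = forged_view n m w t"
    and "\<And>j. 1 \<le> j \<Longrightarrow> j < n \<Longrightarrow> seen n n (attack n m) w t j = map (msg_pair (2 * n) (forged n m w) (j + n)) [0..<t]"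
proof (induction t)
  case 0
  { case 1 show ?case by (simp add: seen_def forged_view_def) next case 2 show ?case by (simp add: seen_def) }
next
  case (Suc t)
  let ?N = "2 * n" and ?V = "forged n m w"
  have N: "2 \<le> ?N" using n by simp
  \<comment> \<open>The chosen data may differ from \<open>w\<close>, but they produce the same view
    and hence the same next message.\<close>
  have "forged_view n m (SOME w'. forged_view n m w' t = forged_view n m w t) t = forged_view n m w t"
    by (rule someI[of "\<lambda>w'. forged_view n m w' t = forged_view n m w t" w]) (rule refl)
  then have sent0: "sent n n (attack n m) w t 0 = forged_send n m w t"
    unfolding sent_def Suc(1) using forged_send_cong[OF n]
    by (simp add: sybil_behaviour_def attack_def forged_view_def)
  have sent: "sent n n (attack n m) w t j = (cw_msg ?N ?V (j + n) t, ccw_msg ?N ?V (j + n) t)" if "1 \<le> j" "j < n" for j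
  proof -
    have "?V (j + n) = w j" using that by (simp add: forged_def)
    then show ?thesis
      using ring_behaviour_honest[OF N, of "j + n" ?V t] that
      unfolding sent_def Suc(2)[OF that] by (simp add: sybil_behaviour_def mult_2)
  qed
  have step: "seen n n (attack n m) w (Suc t) j = seen n n (attack n m) w t j @
      [(fst (sent n n (attack n m) w t ((j + n - 1) mod n)), snd (sent n n (attack n m) w t ((j + 1) mod n)))]" for j
    by (simp add: seen_conv)
  {
    case 1
    have "(0 + n - 1) mod n = n - 1" "(0 + 1) mod n = 1" "n - 1 + n = ?N - 1" using n by auto
    then show ?case unfolding step Suc(1) using sent[of "n - 1"] sent[of 1] n
      by (simp add: forged_view_def)
  next
    case (2 j)
    have "fst (sent n n (attack n m) w t (j - 1)) = cw_msg ?N ?V (j + n - 1) t"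
      using sent[of "j - 1"] sent0 2 by (cases "j = 1") (auto simp: forged_send_def)
    moreover have "snd (sent n n (attack n m) w t ((j + 1) mod n)) = ccw_msg ?N ?V ((j + n + 1) mod ?N) t"
    proof (cases "j + 1 = n")
      case True
      then have "j + n + 1 = ?N" by simp
      then have "(j + n + 1) mod ?N = 0" by (simp only: mod_self)
      then show ?thesis using True sent0 by (simp add: forged_send_def)
    next
      case False
      then show ?thesis using sent[of "j + 1"] 2 by simp
    qed
    moreover have "(j + n - 1) mod n = j - 1" "(j + n + ?N - 1) mod ?N = j + n - 1" using 2 by (intro pred_mod; simp)+
    ultimately show ?case unfolding step Suc(2)[OF 2] by (simp add: msg_pair_def)
  }
qed

text \<open>The honest agents see an honest execution whose inputs sum to \<open>0\<close>, so they
  accept and output \<open>0\<close>, as the cheater always does.\<close>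

lemma success_attack:
  assumes n: "2 \<le> n" "length L = 2 * n"
    and w: "\<And>j. 1 \<le> j \<Longrightarrow> j < n \<Longrightarrow> w j \<in> privates (sum_task m)"
  shows "success 0 (outputs ring_protocol (sum_task m) n L (attack n m) w)"
proof -
  let ?V = "forged n m w" and ?T = "sum_task m"
  have L: "length L = n + n" "2 \<le> length L" using n by simp_all
  have V: "?V i \<in> privates ?T" if "i < length L" for i
    using w[of "i - n"] that n by (auto simp: forged_def forged_input_def privates_def)
  define s where "s = (\<Sum>j=1..<n. fst (w j))"
  have "(\<Sum>i<length L. fst (?V i)) = fst (?V 0) + (\<Sum>i=1..<n + n. fst (?V i))"
  proof -
    have "{..<length L} = insert 0 {1..<n + n}" using L n by auto
    then show ?thesis by simp
  qed
  also have "(\<Sum>i=1..<n + n. fst (?V i)) = (\<Sum>i=1..<n + 1. fst (?V i)) + (\<Sum>i=n + 1..<n + n. fst (?V i))"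
    using n by (intro sum.atLeastLessThan_concat[symmetric]) auto
  also have "(\<Sum>i=1..<n + 1. fst (?V i)) = 0" by (simp add: forged_def)
  also have "(\<Sum>i=n + 1..<n + n. fst (?V i)) = s"
    using sum.shift_bounds_nat_ivl[of "\<lambda>i. fst (?V i)" 1 n n] by (simp add: s_def forged_def add.commute)
  also have "fst (?V 0) = (2 ^ m - s mod 2 ^ m) mod 2 ^ m" by (simp add: forged_def forged_input_def s_def)
  finally have "(\<Sum>i<length L. fst (?V i)) = (2 ^ m - s mod 2 ^ m) mod 2 ^ m + s" by simp
  then have "(\<Sum>i<length L. fst (?V i)) mod 2 ^ m = ((2 ^ m - s mod 2 ^ m) + s mod 2 ^ m) mod 2 ^ m"
    by (simp only: mod_add_left_eq mod_add_right_eq)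
  also have "(2 ^ m - s mod 2 ^ m) + s mod 2 ^ m = 2 ^ m" by (simp add: less_imp_le)
  finally have sum: "(\<Sum>i<length L. fst (?V i)) mod 2 ^ m = 0" by simp
  have out: "outputs ring_protocol ?T n L (attack n m) w ! j = Some 0" if "j < n" for j
  proof (cases "j = 0")
    case True
    then show ?thesis using n by (simp add: outputs_ring_protocol[OF L(1)] attack_def)
  next
    case False
    then have j: "1 \<le> j" "j + n < length L" using that n by auto
    have "?V (j + n) = w j" using False by (simp add: forged_def)
    then have "ring_output ?T L (j + n) (w j) (map (msg_pair (length L) ?V (j + n)) [0..<2 * length L]) = Some 0"
      using ring_output_honest[OF L(2) j(2) V, of "\<lambda>i. i"] sum by (simp add: eval_fn_sum_task)
    then show ?thesis
      using that False n seen_attack(2)[OF n(1) j(1) that, of m w "2 * (n + n)"]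
      by (simp add: outputs_ring_protocol[OF L(1)] mult_2)
  qed
  moreover have "length (outputs ring_protocol ?T n L (attack n m) w) = n" by (simp add: outputs_ring_protocol[OF L(1)])
  ultimately show ?thesis using n(1)
    by (auto simp: success_def legal_def in_set_conv_nth intro!: exI[of _ 0])
qed

text \<open>With \<open>d = \<alpha> + 1\<close> the attack wins for certain if
  \<open>n = \<alpha>\<close>, where \<open>2 * \<alpha> \<le> \<beta>\<close> keeps it undetected.
  The choice \<open>k = 2 ^ \<beta>\<close> makes \<open>1 / k\<close> smaller than the probability
  \<open>1 / (\<beta> - \<alpha> + 1)\<close> of this case.\<close>

lemma not_initial_equilibrium_ring_protocol:
  assumes ab: "2 \<le> \<alpha>" "2 * \<alpha> \<le> \<beta>" and Ids: "finite Ids" "\<beta> \<le> card Ids"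
  shows "\<not> initial_equilibrium ring_protocol \<alpha> \<beta> Ids (sum_task \<beta>)"
proof
  let ?T = "sum_task \<beta>"
  assume eq: "initial_equilibrium ring_protocol \<alpha> \<beta> Ids ?T"
  have T: "k_task (2 ^ \<beta>) ?T" by (rule k_task_sum_task)
  obtain me where me: "me \<in> Ids" using Ids ab by fastforce
  obtain fids where fids: "length fids = \<alpha> + 1" "distinct fids" "set fids \<subseteq> Ids"
    using random_ids(2)[OF Ids(1), of "[]" "\<alpha> + 1"] ab Ids(2) by auto
  define P where "P = return_pmf (fids, \<lambda>L :: nat list. attack \<alpha> \<beta>)"
  have "valid_plan Ids P" using fids by (auto simp: valid_plan_def P_def)
  then have "expected_utility 0 (initial_outcome ring_protocol \<alpha> \<beta> Ids ?T P)
      \<le> expected_utility 0 (initial_outcome ring_protocol \<alpha> \<beta> Ids ?T (honest_plan ring_protocol ?T me 0))"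
    using eq me unfolding initial_equilibrium_def by auto
  also have "\<dots> = chance ?T 0"
    by (rule initial_outcome_honest[OF T]) (use ab Ids me in auto)
  also have "\<dots> = 1 / 2 ^ \<beta>" by (simp add: chance_def fn_range_sum_task)
  finally have le: "expected_utility 0 (initial_outcome ring_protocol \<alpha> \<beta> Ids ?T P) \<le> 1 / 2 ^ \<beta>" .
  define out where "out n =
      (if length fids + n - 1 > \<beta> then return_pmf (replicate n None)
       else do {
         ids \<leftarrow> pmf_of_set {ids. length ids = n - 1 \<and> distinct ids \<and> set ids \<subseteq> Ids - set fids};
         w \<leftarrow> pmf_of_set (privates_of_others ?T n);
         return_pmf (outputs ring_protocol ?T n (fids @ ids) (attack \<alpha> \<beta>) w)
       })" for n
  have outcome: "initial_outcome ring_protocol \<alpha> \<beta> Ids ?T P = bind_pmf (pmf_of_set {\<alpha>..\<beta>}) out"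
    unfolding initial_outcome_def P_def bind_return_pmf out_def privates_of_others_def by simp
  have win: "expected_utility 0 (out \<alpha>) = 1"
  proof -
    have *: "\<not> length fids + \<alpha> - 1 > \<beta>" using fids ab by simp
    show ?thesis
      unfolding out_def if_not_P[OF *]
    proof (intro expected_utility_bind_eq)
      fix ids w
      assume "ids \<in> set_pmf (pmf_of_set {ids. length ids = \<alpha> - 1 \<and> distinct ids \<and> set ids \<subseteq> Ids - set fids})"
        and w: "w \<in> set_pmf (pmf_of_set (privates_of_others ?T \<alpha>))"
      then have "length ids = \<alpha> - 1"
        using random_ids[OF Ids(1) fids(3,2), of "\<alpha> - 1"] fids ab Ids(2) by (simp add: set_pmf_of_set)
      then have "success 0 (outputs ring_protocol ?T \<alpha> (fids @ ids) (attack \<alpha> \<beta>) w)"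
        using fids ab w privates_of_others[OF T] by (intro success_attack) (auto simp: set_pmf_of_set)
      then show "expected_utility 0 (return_pmf (outputs ring_protocol ?T \<alpha> (fids @ ids) (attack \<alpha> \<beta>) w)) = 1"
        by (simp add: utility_success)
    qed
  qed
  \<comment> \<open>Only the summand \<open>n = \<alpha>\<close> is kept; the others are
    nonnegative.\<close>
  have "1 \<le> (\<Sum>n\<in>{\<alpha>..\<beta>}. expected_utility 0 (out n))"
    unfolding win[symmetric] using ab by (intro member_le_sum expected_utility_bounds) auto
  then have "1 / card {\<alpha>..\<beta>} \<le> expected_utility 0 (initial_outcome ring_protocol \<alpha> \<beta> Ids ?T P)"
    unfolding outcome using ab by (subst expected_utility_bind_pmf_of_set) (auto intro: divide_right_mono)
  with le have "1 / card {\<alpha>..\<beta>} \<le> 1 / (2 :: real) ^ \<beta>" by simp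
  moreover have "real (card {\<alpha>..\<beta>}) < 2 ^ \<beta>"
  proof -
    have "card {\<alpha>..\<beta>} \<le> \<beta>" using ab by simp
    also have "\<beta> < 2 ^ \<beta>" by (rule less_exp)
    finally show ?thesis by (metis of_nat_less_iff of_nat_numeral of_nat_power)
  qed
  moreover have "0 < card {\<alpha>..\<beta>}" using ab by simp
  moreover have "\<not> 1 / real c \<le> 1 / 2 ^ \<beta>" if "real c < 2 ^ \<beta>" "0 < c" for c
    using that by (simp add: field_simps)
  ultimately show False by blast
qed

theorem mainTheorem5:
  fixes \<alpha> \<beta> :: nat and Ids :: "nat set"
  assumes "2 \<le> \<alpha>" and "\<alpha> \<le> \<beta>"
    and "finite Ids" and "\<beta> \<le> card Ids"
  shows "knowledge_sharing_equilibrium ring_protocol \<alpha> \<beta> Ids \<longleftrightarrow> \<beta> \<le> 2 * \<alpha> - 1"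
proof
  assume "knowledge_sharing_equilibrium ring_protocol \<alpha> \<beta> Ids"
  then have "initial_equilibrium ring_protocol \<alpha> \<beta> Ids (sum_task \<beta>)"
    using k_task_sum_task by (auto simp: knowledge_sharing_equilibrium_def k_knowledge_sharing_equilibrium_def)
  then show "\<beta> \<le> 2 * \<alpha> - 1"
    using not_initial_equilibrium_ring_protocol[of \<alpha> \<beta> Ids] assms by linarith
next
  assume le: "\<beta> \<le> 2 * \<alpha> - 1"
  show "knowledge_sharing_equilibrium ring_protocol \<alpha> \<beta> Ids"
    unfolding knowledge_sharing_equilibrium_def k_knowledge_sharing_equilibrium_def
  proof (intro allI impI conjI)
    fix k T
    assume T: "k_task k T"
    show "solves ring_protocol \<alpha> \<beta> Ids T" using T assms(1) by (rule solves_ring_protocol)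
    show "initial_equilibrium ring_protocol \<alpha> \<beta> Ids T"
      using T assms(1,2) le assms(3,4) by (rule initial_equilibrium_ring_protocol)
    show "later_equilibrium ring_protocol \<alpha> \<beta> Ids T" using T assms(1) by (rule later_equilibrium_ring_protocol)
  qed
qed

end
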